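(* Let $\pi:P_h\to X$ be the principal $S^1$ bundle with Kaluza-Klein metric $G=G(g,h,\nabla)$ described in the context. The invariant (weight $m=0$) eigenfunctions of $\Delta_G$ are the lifts $\pi^*\psi_j$ of eigenfunctions $\psi_j$ of the Laplacian $\Delta_g$ on the base $X$. The nodal set of $\pi^*\psi_j$ is the inverse image under $\pi$ of the nodal set of $\psi_j$, and the number of nodal domains of $\pi^*\psi_j$ equals the number of nodal domains of $\psi_j$.
   Context: $X$ is a compact connected surface with Riemannian metric $g$ and compatible complex structure $J$; $(L,h)\to X$ is a holomorphic line bundle with Hermitian metric $h$; $\nabla$ is an $h$-compatible connection on $L$. $P_h=\{(z,\lambda)\in L^*: |\lambda|_{h^*}=1\}$ is the associated principal $S^1=U(1)$ bundle, with projection $\pi$ and with $\partial/\partial\theta$ the generator of the $S^1$ action. The connection induces a splitting $TP_h=H\oplus V$ into horizontal and vertical spaces, $V=\mathbb{R}\,\partial/\partial\theta$. The Kaluza-Klein metric $G$ is the $S^1$-invariant metric for which $H\perp V$, $d\pi:H_p\to T_{\pi(p)}X$ is an isometry, and the $S^1$-orbits are unit speed geodesics (so $|\partial/\partial\theta|_G=1$). $\Delta_G$ is its Laplacian. A function has weight $m$ if $\frac{\partial}{\partial\theta}\phi=im\phi$. Eigenfunctions of weight $0$ are taken real-valued. Nodal set means zero set; nodal domains are the connected components of its complement. *)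

theory Defs
  imports "HOL-Analysis.Analysis"
begin

section \<open>Smooth manifolds given by atlases\<close>

text \<open>Only meant for open sets: continuous partial derivatives up to order \<open>k\<close>.\<close>

fun times_differentiable_on ::
    "nat \<Rightarrow> 'e::euclidean_space set \<Rightarrow> ('e \<Rightarrow> 'b::real_normed_vector) \<Rightarrow> bool" where
  "times_differentiable_on 0 S f \<longleftrightarrow> continuous_on S f"
| "times_differentiable_on (Suc k) S f \<longleftrightarrow>
     (\<forall>x\<in>S. f differentiable (at x)) \<and>
     (\<forall>v. times_differentiable_on k S (\<lambda>x. frechet_derivative f (at x) v))"

definition smooth_on :: "'e::euclidean_space set \<Rightarrow> ('e \<Rightarrow> 'b::real_normed_vector) \<Rightarrow> bool" where
  "smooth_on S f \<longleftrightarrow> (\<forall>k. times_differentiable_on k S f)"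

text \<open>
  A chart is a pair of its domain and its coordinate map into the Euclidean model space.
  A manifold is represented by an atlas; its points and its topology are determined by the charts.
\<close>

type_synonym ('a, 'e) chart = "'a set \<times> ('a \<Rightarrow> 'e)"

definition carrier_of :: "('a, 'e) chart set \<Rightarrow> 'a set" where
  "carrier_of A = (\<Union>c\<in>A. fst c)"

definition chart_image :: "('a, 'e) chart \<Rightarrow> 'a set \<Rightarrow> 'e set" where
  "chart_image c W = snd c ` (fst c \<inter> W)"

definition chart_inv :: "('a, 'e) chart \<Rightarrow> 'e \<Rightarrow> 'a" where
  "chart_inv c = inv_into (fst c) (snd c)"

definition smooth_atlas :: "('a, 'e::euclidean_space) chart set \<Rightarrow> bool" where
  "smooth_atlas A \<longleftrightarrow>
     (\<forall>c\<in>A. inj_on (snd c) (fst c)) \<and>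
     (\<forall>c\<in>A. \<forall>c'\<in>A. open (chart_image c (fst c')) \<and>
        smooth_on (chart_image c (fst c')) (snd c' \<circ> chart_inv c))"

text \<open>One-dimensional: the charts take values in the complex plane.\<close>

definition complex_atlas :: "('a, complex) chart set \<Rightarrow> bool" where
  "complex_atlas A \<longleftrightarrow>
     (\<forall>c\<in>A. inj_on (snd c) (fst c)) \<and>
     (\<forall>c\<in>A. \<forall>c'\<in>A. open (chart_image c (fst c')) \<and>
        (snd c' \<circ> chart_inv c) holomorphic_on (chart_image c (fst c')))"

definition atlas_topology :: "('a, 'e::euclidean_space) chart set \<Rightarrow> 'a topology" where
  "atlas_topology A = topology (\<lambda>W. W \<subseteq> carrier_of A \<and>
     (\<forall>c\<in>A. open {y \<in> snd c ` fst c. chart_inv c y \<in> W}))"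

lemma openin_atlas_topology:
  "openin (atlas_topology A) W \<longleftrightarrow> W \<subseteq> carrier_of A \<and>
     (\<forall>c\<in>A. open {y \<in> snd c ` fst c. chart_inv c y \<in> W})"
proof -
  have "istopology (\<lambda>W. W \<subseteq> carrier_of A \<and>
     (\<forall>c\<in>A. open {y \<in> snd c ` fst c. chart_inv c y \<in> W}))"
    unfolding istopology_def
  proof (intro conjI allI impI ballI)
    fix S T c
    assume S: "S \<subseteq> carrier_of A \<and> (\<forall>c\<in>A. open {y \<in> snd c ` fst c. chart_inv c y \<in> S})"
      and T: "T \<subseteq> carrier_of A \<and> (\<forall>c\<in>A. open {y \<in> snd c ` fst c. chart_inv c y \<in> T})"
    show "S \<inter> T \<subseteq> carrier_of A" using S by blast
    assume "c \<in> A"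
    then have "open ({y \<in> snd c ` fst c. chart_inv c y \<in> S} \<inter> {y \<in> snd c ` fst c. chart_inv c y \<in> T})"
      using S T by blast
    also have "{y \<in> snd c ` fst c. chart_inv c y \<in> S} \<inter> {y \<in> snd c ` fst c. chart_inv c y \<in> T}
        = {y \<in> snd c ` fst c. chart_inv c y \<in> S \<inter> T}"
      by blast
    finally show "open {y \<in> snd c ` fst c. chart_inv c y \<in> S \<inter> T}" .
  next
    fix K c
    assume K: "\<forall>W\<in>K. W \<subseteq> carrier_of A \<and> (\<forall>c\<in>A. open {y \<in> snd c ` fst c. chart_inv c y \<in> W})"
    show "\<Union>K \<subseteq> carrier_of A" using K by blast
    assume "c \<in> A"
    then have "open (\<Union>W\<in>K. {y \<in> snd c ` fst c. chart_inv c y \<in> W})"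
      using K by blast
    also have "(\<Union>W\<in>K. {y \<in> snd c ` fst c. chart_inv c y \<in> W}) =
        {y \<in> snd c ` fst c. chart_inv c y \<in> \<Union>K}"
      by blast
    finally show "open {y \<in> snd c ` fst c. chart_inv c y \<in> \<Union>K}" .
  qed
  then show ?thesis
    by (simp add: atlas_topology_def topology_inverse')
qed

definition smooth_fun ::
    "('a, 'e::euclidean_space) chart set \<Rightarrow> 'a set \<Rightarrow> ('a \<Rightarrow> 'b::real_normed_vector) \<Rightarrow> bool" where
  "smooth_fun A W f \<longleftrightarrow> (\<forall>c\<in>A. smooth_on (chart_image c W) (f \<circ> chart_inv c))"

definition smooth_near ::
    "('a, 'e::euclidean_space) chart set \<Rightarrow> 'a \<Rightarrow> ('a \<Rightarrow> 'b::real_normed_vector) \<Rightarrow> bool" where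
  "smooth_near A x f \<longleftrightarrow> (\<exists>W. openin (atlas_topology A) W \<and> x \<in> W \<and> smooth_fun A W f)"

text \<open>
  A tangent vector at \<open>x\<close> is the directional derivative operator it induces on the functions
  that are smooth near \<open>x\<close>; it is extended by \<open>0\<close> to all other functions, which makes it
  independent of the chart used to write it.
\<close>

type_synonym 'a tangent = "('a \<Rightarrow> real) \<Rightarrow> real"

definition tangent_vector ::
    "('a, 'e::euclidean_space) chart set \<Rightarrow> ('a, 'e) chart \<Rightarrow> 'a \<Rightarrow> 'e \<Rightarrow> 'a tangent" where
  "tangent_vector A c x v = (\<lambda>f. if smooth_near A x f
     then frechet_derivative (f \<circ> chart_inv c) (at (snd c x)) v else 0)"

definition tangent_space :: "('a, 'e::euclidean_space) chart set \<Rightarrow> 'a \<Rightarrow> 'a tangent set" where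
  "tangent_space A x = {tangent_vector A c x v | c v. c \<in> A \<and> x \<in> fst c}"

definition tangent_add :: "'a tangent \<Rightarrow> 'a tangent \<Rightarrow> 'a tangent" where
  "tangent_add D E = (\<lambda>f. D f + E f)"

definition tangent_scale :: "real \<Rightarrow> 'a tangent \<Rightarrow> 'a tangent" where
  "tangent_scale r D = (\<lambda>f. r * D f)"

definition differential ::
    "('b, 'e::euclidean_space) chart set \<Rightarrow> ('a \<Rightarrow> 'b) \<Rightarrow> 'a \<Rightarrow> 'a tangent \<Rightarrow> 'b tangent" where
  "differential B F x D = (\<lambda>f. if smooth_near B (F x) f then D (f \<circ> F) else 0)"

definition complex_derivative :: "'a tangent \<Rightarrow> ('a \<Rightarrow> complex) \<Rightarrow> complex" where
  "complex_derivative D f = Complex (D (\<lambda>x. Re (f x))) (D (\<lambda>x. Im (f x)))"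


section \<open>Riemannian metrics, geodesics and the Laplacian\<close>

type_synonym 'a metric_field = "'a \<Rightarrow> 'a tangent \<Rightarrow> 'a tangent \<Rightarrow> real"

definition metric_in_chart :: "('a, 'e::euclidean_space) chart set \<Rightarrow> 'a metric_field \<Rightarrow>
    ('a, 'e) chart \<Rightarrow> 'e \<Rightarrow> 'e \<Rightarrow> 'e \<Rightarrow> real" where
  "metric_in_chart A g c y v w =
     g (chart_inv c y) (tangent_vector A c (chart_inv c y) v) (tangent_vector A c (chart_inv c y) w)"

definition riemannian_metric :: "('a, 'e::euclidean_space) chart set \<Rightarrow> 'a metric_field \<Rightarrow> bool" where
  "riemannian_metric A g \<longleftrightarrow>
     (\<forall>x\<in>carrier_of A. \<forall>D\<in>tangent_space A x.
        (\<forall>E\<in>tangent_space A x. g x D E = g x E D \<and>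
           (\<forall>r. g x (tangent_scale r D) E = r * g x D E) \<and>
           (\<forall>D'\<in>tangent_space A x. g x (tangent_add D D') E = g x D E + g x D' E)) \<and>
        (D \<noteq> (\<lambda>_. 0) \<longrightarrow> g x D D > 0)) \<and>
     (\<forall>c\<in>A. \<forall>v w. smooth_on (snd c ` fst c) (\<lambda>y. metric_in_chart A g c y v w))"

text \<open>In a holomorphic chart the complex structure acts by multiplication with the imaginary unit.\<close>

definition compatible_with_complex_structure ::
    "('a, complex) chart set \<Rightarrow> 'a metric_field \<Rightarrow> bool" where
  "compatible_with_complex_structure A g \<longleftrightarrow>
     (\<forall>c\<in>A. \<forall>x\<in>fst c. \<forall>v w.
        g x (tangent_vector A c x (\<i> * v)) (tangent_vector A c x (\<i> * w)) =
        g x (tangent_vector A c x v) (tangent_vector A c x w))"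

text \<open>
  The geodesic equation in a chart, paired with an arbitrary vector \<open>w\<close>. The last two summands
  are the Christoffel symbols of the first kind contracted twice with the velocity.
\<close>

definition geodesic :: "('a, 'e::euclidean_space) chart set \<Rightarrow> 'a metric_field \<Rightarrow> (real \<Rightarrow> 'a) \<Rightarrow> bool" where
  "geodesic A g \<gamma> \<longleftrightarrow> range \<gamma> \<subseteq> carrier_of A \<and>
     (\<forall>c\<in>A. \<forall>t. \<gamma> t \<in> fst c \<longrightarrow>
        (\<exists>S. open S \<and> t \<in> S \<and> \<gamma> ` S \<subseteq> fst c \<and> smooth_on S (snd c \<circ> \<gamma>)) \<and>
        (let y = snd c \<circ> \<gamma>;
             y' = (\<lambda>s. vector_derivative y (at s));
             y'' = vector_derivative y' (at t);
             m = metric_in_chart A g c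
         in \<forall>w. m (y t) y'' w
              + frechet_derivative (\<lambda>q. m q (y' t) w) (at (y t)) (y' t)
              - frechet_derivative (\<lambda>q. m q (y' t) (y' t)) (at (y t)) w / 2 = 0))"

text \<open>Determinant of the Gram matrix of a bilinear form with respect to the standard basis.\<close>

definition gram_det :: "('e::euclidean_space \<Rightarrow> 'e \<Rightarrow> real) \<Rightarrow> real" where
  "gram_det B = (\<Sum>p | p permutes Basis. of_int (sign p) * (\<Prod>b\<in>Basis. B b (p b)))"

definition volume_density :: "('a, 'e::euclidean_space) chart set \<Rightarrow> 'a metric_field \<Rightarrow>
    ('a, 'e) chart \<Rightarrow> 'e \<Rightarrow> real" where
  "volume_density A g c y = sqrt (gram_det (metric_in_chart A g c y))"

definition gradient_in_chart :: "('a, 'e::euclidean_space) chart set \<Rightarrow> 'a metric_field \<Rightarrow>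
    ('a, 'e) chart \<Rightarrow> ('a \<Rightarrow> real) \<Rightarrow> 'e \<Rightarrow> 'e" where
  "gradient_in_chart A g c f y =
     (THE u. \<forall>v. metric_in_chart A g c y u v = frechet_derivative (f \<circ> chart_inv c) (at y) v)"

definition laplacian_in_chart :: "('a, 'e::euclidean_space) chart set \<Rightarrow> 'a metric_field \<Rightarrow>
    ('a, 'e) chart \<Rightarrow> ('a \<Rightarrow> real) \<Rightarrow> 'e \<Rightarrow> real" where
  "laplacian_in_chart A g c f y =
     (\<Sum>b\<in>Basis. frechet_derivative
        (\<lambda>q. volume_density A g c q * (gradient_in_chart A g c f q \<bullet> b)) (at y) b)
     / volume_density A g c y"

text \<open>
  \<open>u\<close> is the Laplacian (divergence of the gradient) of \<open>f\<close>. The chart expression is invariant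
  under coordinate changes, so asking for it in all charts is the same as asking for it in one
  chart around each point.
\<close>

definition has_laplacian :: "('a, 'e::euclidean_space) chart set \<Rightarrow> 'a metric_field \<Rightarrow>
    ('a \<Rightarrow> real) \<Rightarrow> ('a \<Rightarrow> real) \<Rightarrow> bool" where
  "has_laplacian A g f u \<longleftrightarrow>
     (\<forall>c\<in>A. \<forall>x\<in>fst c. laplacian_in_chart A g c f (snd c x) = u x)"

definition eigenfunction :: "('a, 'e::euclidean_space) chart set \<Rightarrow> 'a metric_field \<Rightarrow>
    ('a \<Rightarrow> real) \<Rightarrow> bool" where
  "eigenfunction A g f \<longleftrightarrow> smooth_fun A (carrier_of A) f \<and> (\<exists>x\<in>carrier_of A. f x \<noteq> 0) \<and>
     (\<exists>\<mu>::real. has_laplacian A g f (\<lambda>x. - \<mu> * f x))"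

definition nodal_set :: "('a, 'e) chart set \<Rightarrow> ('a \<Rightarrow> real) \<Rightarrow> 'a set" where
  "nodal_set A f = {x \<in> carrier_of A. f x = 0}"

definition nodal_domains :: "('a, 'e::euclidean_space) chart set \<Rightarrow> ('a \<Rightarrow> real) \<Rightarrow> 'a set set" where
  "nodal_domains A f =
     connected_components_of (subtopology (atlas_topology A) (carrier_of A - nodal_set A f))"


section \<open>Hermitian holomorphic line bundles and connections\<close>

text \<open>
  The total space is the disjoint union of the fibres. A local trivialization is an open set
  together with a family of complex-linear isomorphisms from the fibres over it to the complex
  numbers.
\<close>

record ('x, 'l) line_bundle =
  fibre :: "'x \<Rightarrow> 'l set"
  fibre_add :: "'x \<Rightarrow> 'l \<Rightarrow> 'l \<Rightarrow> 'l"
  fibre_scale :: "'x \<Rightarrow> complex \<Rightarrow> 'l \<Rightarrow> 'l"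
  trivializations :: "('x set \<times> ('x \<Rightarrow> 'l \<Rightarrow> complex)) set"

definition holomorphic_fun :: "('x, complex) chart set \<Rightarrow> 'x set \<Rightarrow> ('x \<Rightarrow> complex) \<Rightarrow> bool" where
  "holomorphic_fun A W f \<longleftrightarrow> (\<forall>c\<in>A. (f \<circ> chart_inv c) holomorphic_on (chart_image c W))"

definition holomorphic_line_bundle :: "('x, complex) chart set \<Rightarrow> ('x, 'l) line_bundle \<Rightarrow> bool" where
  "holomorphic_line_bundle A L \<longleftrightarrow>
     (\<forall>z\<in>carrier_of A. \<forall>u\<in>fibre L z. (\<forall>v\<in>fibre L z. fibre_add L z u v \<in> fibre L z) \<and>
        (\<forall>a. fibre_scale L z a u \<in> fibre L z)) \<and>
     carrier_of A = (\<Union>(U, \<tau>)\<in>trivializations L. U) \<and>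
     (\<forall>(U, \<tau>)\<in>trivializations L. openin (atlas_topology A) U \<and>
        (\<forall>z\<in>U. bij_betw (\<tau> z) (fibre L z) UNIV \<and>
           (\<forall>u\<in>fibre L z. (\<forall>v\<in>fibre L z. \<tau> z (fibre_add L z u v) = \<tau> z u + \<tau> z v) \<and>
              (\<forall>a. \<tau> z (fibre_scale L z a u) = a * \<tau> z u)))) \<and>
     (\<forall>(U, \<tau>)\<in>trivializations L. \<forall>(U', \<tau>')\<in>trivializations L.
        \<exists>t. holomorphic_fun A (U \<inter> U') t \<and>
          (\<forall>z\<in>U \<inter> U'. t z \<noteq> 0 \<and> (\<forall>u\<in>fibre L z. \<tau>' z u = t z * \<tau> z u)))"

definition unit_frame :: "('x, 'l) line_bundle \<Rightarrow> ('x \<Rightarrow> 'l \<Rightarrow> complex) \<Rightarrow> 'x \<Rightarrow> 'l" where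
  "unit_frame L \<tau> z = inv_into (fibre L z) (\<tau> z) 1"

definition smooth_section :: "('x, 'e::euclidean_space) chart set \<Rightarrow> ('x, 'l) line_bundle \<Rightarrow>
    'x set \<Rightarrow> ('x \<Rightarrow> 'l) \<Rightarrow> bool" where
  "smooth_section A L W s \<longleftrightarrow> (\<forall>z\<in>W. s z \<in> fibre L z) \<and>
     (\<forall>(U, \<tau>)\<in>trivializations L. smooth_fun A (W \<inter> U) (\<lambda>z. \<tau> z (s z)))"

definition smooth_section_near :: "('x, 'e::euclidean_space) chart set \<Rightarrow> ('x, 'l) line_bundle \<Rightarrow>
    'x \<Rightarrow> ('x \<Rightarrow> 'l) \<Rightarrow> bool" where
  "smooth_section_near A L x s \<longleftrightarrow>
     (\<exists>W. openin (atlas_topology A) W \<and> x \<in> W \<and> smooth_section A L W s)"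

definition hermitian_metric :: "('x, 'e::euclidean_space) chart set \<Rightarrow> ('x, 'l) line_bundle \<Rightarrow>
    ('x \<Rightarrow> 'l \<Rightarrow> 'l \<Rightarrow> complex) \<Rightarrow> bool" where
  "hermitian_metric A L h \<longleftrightarrow>
     (\<forall>z\<in>carrier_of A. \<forall>u\<in>fibre L z.
        (\<forall>v\<in>fibre L z. h z v u = cnj (h z u v) \<and>
           (\<forall>a. h z (fibre_scale L z a u) v = a * h z u v) \<and>
           (\<forall>u'\<in>fibre L z. h z (fibre_add L z u u') v = h z u v + h z u' v)) \<and>
        (u \<noteq> fibre_scale L z 0 u \<longrightarrow> Re (h z u u) > 0)) \<and>
     (\<forall>W s s'. openin (atlas_topology A) W \<and> smooth_section A L W s \<and> smooth_section A L W s' \<longrightarrow>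
        smooth_fun A W (\<lambda>z. h z (s z) (s' z)))"

text \<open>
  A connection is a covariant derivative acting on local smooth sections: \<open>nabla s x D\<close> is the
  derivative at \<open>x\<close> of a section \<open>s\<close> defined near \<open>x\<close> in direction \<open>D\<close>, and only depends on the
  germ of \<open>s\<close> at \<open>x\<close>.
\<close>

type_synonym ('x, 'l) covariant_derivative = "('x \<Rightarrow> 'l) \<Rightarrow> 'x \<Rightarrow> 'x tangent \<Rightarrow> 'l"

definition connection :: "('x, 'e::euclidean_space) chart set \<Rightarrow> ('x, 'l) line_bundle \<Rightarrow>
    ('x, 'l) covariant_derivative \<Rightarrow> bool" where
  "connection A L nabla \<longleftrightarrow>
     (\<forall>x\<in>carrier_of A. \<forall>s. smooth_section_near A L x s \<longrightarrow>
        (\<forall>D\<in>tangent_space A x.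
           nabla s x D \<in> fibre L x \<and>
           (\<forall>E\<in>tangent_space A x.
              nabla s x (tangent_add D E) = fibre_add L x (nabla s x D) (nabla s x E)) \<and>
           (\<forall>r. nabla s x (tangent_scale r D) = fibre_scale L x (complex_of_real r) (nabla s x D)) \<and>
           (\<forall>s' W. openin (atlas_topology A) W \<and> x \<in> W \<and> (\<forall>z\<in>W. s' z = s z) \<longrightarrow>
              nabla s' x D = nabla s x D) \<and>
           (\<forall>s'. smooth_section_near A L x s' \<longrightarrow>
              nabla (\<lambda>z. fibre_add L z (s z) (s' z)) x D = fibre_add L x (nabla s x D) (nabla s' x D)) \<and>
           (\<forall>f. smooth_near A x f \<longrightarrow>
              nabla (\<lambda>z. fibre_scale L z (f z) (s z)) x D =
                fibre_add L x (fibre_scale L x (complex_derivative D f) (s x))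
                              (fibre_scale L x (f x) (nabla s x D))))) \<and>
     (\<forall>W s c v. openin (atlas_topology A) W \<and> smooth_section A L W s \<and> c \<in> A \<longrightarrow>
        smooth_section A L (W \<inter> fst c) (\<lambda>z. nabla s z (tangent_vector A c z v)))"

definition metric_connection :: "('x, 'e::euclidean_space) chart set \<Rightarrow> ('x, 'l) line_bundle \<Rightarrow>
    ('x \<Rightarrow> 'l \<Rightarrow> 'l \<Rightarrow> complex) \<Rightarrow> ('x, 'l) covariant_derivative \<Rightarrow> bool" where
  "metric_connection A L h nabla \<longleftrightarrow> connection A L nabla \<and>
     (\<forall>x\<in>carrier_of A. \<forall>s s'. smooth_section_near A L x s \<and> smooth_section_near A L x s' \<longrightarrow>
        (\<forall>D\<in>tangent_space A x.
           complex_derivative D (\<lambda>z. h z (s z) (s' z)) =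
             h x (nabla s x D) (s' x) + h x (s x) (nabla s' x D)))"


section \<open>The unit circle bundle in the dual line bundle\<close>

text \<open>Functionals are made extensional by the value \<open>0\<close> outside of the fibre.\<close>

definition dual_fibre :: "('x, 'l) line_bundle \<Rightarrow> 'x \<Rightarrow> ('l \<Rightarrow> complex) set" where
  "dual_fibre L z = {\<xi>.
     (\<forall>u\<in>fibre L z. (\<forall>v\<in>fibre L z. \<xi> (fibre_add L z u v) = \<xi> u + \<xi> v) \<and>
        (\<forall>a. \<xi> (fibre_scale L z a u) = a * \<xi> u)) \<and>
     (\<forall>u. u \<notin> fibre L z \<longrightarrow> \<xi> u = 0)}"

definition dual_norm :: "('x, 'l) line_bundle \<Rightarrow> ('x \<Rightarrow> 'l \<Rightarrow> 'l \<Rightarrow> complex) \<Rightarrow> 'x \<Rightarrow>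
    ('l \<Rightarrow> complex) \<Rightarrow> real" where
  "dual_norm L h z \<xi> = Sup {cmod (\<xi> u) | u. u \<in> fibre L z \<and> sqrt (Re (h z u u)) = 1}"

definition circle_bundle :: "('x, complex) chart set \<Rightarrow> ('x, 'l) line_bundle \<Rightarrow>
    ('x \<Rightarrow> 'l \<Rightarrow> 'l \<Rightarrow> complex) \<Rightarrow> ('x \<times> ('l \<Rightarrow> complex)) set" where
  "circle_bundle A L h =
     {(z, \<xi>). z \<in> carrier_of A \<and> \<xi> \<in> dual_fibre L z \<and> dual_norm L h z \<xi> = 1}"

text \<open>
  Over a chart \<open>c\<close> and a trivialization with frame \<open>e\<close>, a point \<open>(z, \<xi>)\<close> of the circle bundle is
  determined by \<open>z\<close> and the angle of \<open>\<xi> (e z)\<close>, because \<open>\<bar>\<xi> (e z)\<bar>\<close> is the \<open>h\<close>-norm of \<open>e z\<close>.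
  The unit complex number \<open>w\<close> moves the cut of the angle. These coordinates are the ones
  inherited from the dual line bundle.
\<close>

definition circle_bundle_chart :: "('x, complex) chart set \<Rightarrow> ('x, 'l) line_bundle \<Rightarrow>
    ('x \<Rightarrow> 'l \<Rightarrow> 'l \<Rightarrow> complex) \<Rightarrow> ('x, complex) chart \<Rightarrow> 'x set \<times> ('x \<Rightarrow> 'l \<Rightarrow> complex) \<Rightarrow>
    complex \<Rightarrow> ('x \<times> ('l \<Rightarrow> complex), complex \<times> real) chart" where
  "circle_bundle_chart A L h c T w =
     ({(z, \<xi>) \<in> circle_bundle A L h. z \<in> fst c \<inter> fst T \<and>
         \<xi> (unit_frame L (snd T) z) / w \<notin> \<real>\<^sub>\<le>\<^sub>0},
      (\<lambda>(z, \<xi>). (snd c z, Arg (\<xi> (unit_frame L (snd T) z) / w))))"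

definition circle_bundle_atlas :: "('x, complex) chart set \<Rightarrow> ('x, 'l) line_bundle \<Rightarrow>
    ('x \<Rightarrow> 'l \<Rightarrow> 'l \<Rightarrow> complex) \<Rightarrow> ('x \<times> ('l \<Rightarrow> complex), complex \<times> real) chart set" where
  "circle_bundle_atlas A L h =
     {circle_bundle_chart A L h c T w | c T w. c \<in> A \<and> T \<in> trivializations L \<and> cmod w = 1}"

definition bundle_proj :: "'x \<times> ('l \<Rightarrow> complex) \<Rightarrow> 'x" where
  "bundle_proj p = fst p"

definition circle_action :: "real \<Rightarrow> 'x \<times> ('l \<Rightarrow> complex) \<Rightarrow> 'x \<times> ('l \<Rightarrow> complex)" where
  "circle_action t p = (fst p, (\<lambda>u. cis t * snd p u))"

definition action_generator :: "('x \<times> ('l \<Rightarrow> complex), 'e::euclidean_space) chart set \<Rightarrow>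
    'x \<times> ('l \<Rightarrow> complex) \<Rightarrow> ('x \<times> ('l \<Rightarrow> complex)) tangent" where
  "action_generator P p = (\<lambda>f. if smooth_near P p f
     then vector_derivative (\<lambda>t. f (circle_action t p)) (at 0) else 0)"

definition has_weight :: "('x \<times> ('l \<Rightarrow> complex)) set \<Rightarrow> int \<Rightarrow>
    ('x \<times> ('l \<Rightarrow> complex) \<Rightarrow> complex) \<Rightarrow> bool" where
  "has_weight M m \<phi> \<longleftrightarrow> (\<forall>p\<in>M.
     ((\<lambda>t. \<phi> (circle_action t p)) has_vector_derivative (\<i> * of_int m * \<phi> p)) (at 0))"

definition vertical_space :: "('x \<times> ('l \<Rightarrow> complex), 'e::euclidean_space) chart set \<Rightarrow>
    'x \<times> ('l \<Rightarrow> complex) \<Rightarrow> ('x \<times> ('l \<Rightarrow> complex)) tangent set" where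
  "vertical_space P p = range (\<lambda>r. tangent_scale r (action_generator P p))"

definition smooth_unit_dual_section_near :: "('x, complex) chart set \<Rightarrow> ('x, 'l) line_bundle \<Rightarrow>
    ('x \<Rightarrow> 'l \<Rightarrow> 'l \<Rightarrow> complex) \<Rightarrow> 'x \<Rightarrow> ('x \<Rightarrow> 'l \<Rightarrow> complex) \<Rightarrow> bool" where
  "smooth_unit_dual_section_near A L h x \<sigma> \<longleftrightarrow>
     (\<exists>W. openin (atlas_topology A) W \<and> x \<in> W \<and> (\<forall>z\<in>W. (z, \<sigma> z) \<in> circle_bundle A L h) \<and>
        (\<forall>(U, \<tau>)\<in>trivializations L. smooth_fun A (W \<inter> U) (\<lambda>z. \<sigma> z (unit_frame L \<tau> z))))"

text \<open>
  The covariant derivative induced on the dual bundle,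
  \<open>(\<nabla>\<^sub>D \<sigma>) (s) = D (\<sigma> (s)) - \<sigma> (\<nabla>\<^sub>D s)\<close>, vanishes at \<open>x\<close>.
\<close>

definition dual_parallel_at :: "('x, complex) chart set \<Rightarrow> ('x, 'l) line_bundle \<Rightarrow>
    ('x, 'l) covariant_derivative \<Rightarrow> ('x \<Rightarrow> 'l \<Rightarrow> complex) \<Rightarrow> 'x \<Rightarrow> 'x tangent \<Rightarrow> bool" where
  "dual_parallel_at A L nabla \<sigma> x D \<longleftrightarrow>
     (\<forall>s. smooth_section_near A L x s \<longrightarrow>
        complex_derivative D (\<lambda>z. \<sigma> z (s z)) - \<sigma> x (nabla s x D) = 0)"

definition horizontal_space :: "('x, complex) chart set \<Rightarrow> ('x, 'l) line_bundle \<Rightarrow>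
    ('x \<Rightarrow> 'l \<Rightarrow> 'l \<Rightarrow> complex) \<Rightarrow> ('x, 'l) covariant_derivative \<Rightarrow>
    'x \<times> ('l \<Rightarrow> complex) \<Rightarrow> ('x \<times> ('l \<Rightarrow> complex)) tangent set" where
  "horizontal_space A L h nabla p =
     {differential (circle_bundle_atlas A L h) (\<lambda>z. (z, \<sigma> z)) (fst p) D | \<sigma> D.
        smooth_unit_dual_section_near A L h (fst p) \<sigma> \<and> \<sigma> (fst p) = snd p \<and>
        D \<in> tangent_space A (fst p) \<and> dual_parallel_at A L nabla \<sigma> (fst p) D}"

definition kaluza_klein_metric :: "('x, complex) chart set \<Rightarrow> 'x metric_field \<Rightarrow>
    ('x, 'l) line_bundle \<Rightarrow> ('x \<Rightarrow> 'l \<Rightarrow> 'l \<Rightarrow> complex) \<Rightarrow> ('x, 'l) covariant_derivative \<Rightarrow>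
    ('x \<times> ('l \<Rightarrow> complex)) metric_field \<Rightarrow> bool" where
  "kaluza_klein_metric A g L h nabla G \<longleftrightarrow>
     (let P = circle_bundle_atlas A L h; H = horizontal_space A L h nabla; V = vertical_space P in
       riemannian_metric P G \<and>
       (\<forall>p\<in>circle_bundle A L h.
          (\<forall>t. \<forall>D\<in>tangent_space P p. \<forall>E\<in>tangent_space P p.
             G (circle_action t p) (differential P (circle_action t) p D) (differential P (circle_action t) p E) = G p D E) \<and>
          (\<forall>D\<in>H p. \<forall>E\<in>V p. G p D E = 0) \<and>
          (\<forall>D\<in>H p. \<forall>E\<in>H p. G p D E =
             g (bundle_proj p) (differential A bundle_proj p D) (differential A bundle_proj p E)) \<and>
          G p (action_generator P p) (action_generator P p) = 1 \<and>
          geodesic P G (\<lambda>t. circle_action t p)))"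

end

theory Submission
  imports Defs "HOL-Complex_Analysis.Complex_Analysis"
begin

text \<open>
  The proof is a computation in bundle coordinates. Over a chart \<open>c\<close> of the surface and a local
  frame \<open>e\<close> of the line bundle, a unit covector \<open>\<xi>\<close> at the point with coordinate \<open>y\<close> is determined
  by \<open>y\<close> and by the angle \<open>t\<close> of \<open>\<xi> e\<close>. In these coordinates the circle action translates \<open>t\<close>, the
  projection forgets \<open>t\<close>, and a covariant derivative has a local connection form whose imaginary
  part \<open>\<beta>\<close> is the angular velocity of a parallel unit covector. So the vertical vectors are the
  multiples of \<open>(0, 1)\<close>, the horizontal lift of \<open>v\<close> is \<open>(v, \<beta> v)\<close> (\<open>horizontal_lift\<close>), and the
  axioms of the Kaluza-Klein metric leave only
  \<open>((v, r), (v', r')) \<mapsto> g (v, v') + (r - \<beta> v) (r' - \<beta> v')\<close> (\<open>metric_in_chart_kaluza_klein\<close>).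

  This form has the same Gram determinant as \<open>g\<close>, and the gradient of a function of \<open>y\<close> alone is the
  horizontal lift \<open>(u, \<beta> u)\<close> of its gradient \<open>u\<close> on the surface. Density and gradient are independent
  of \<open>t\<close>, so the vertical component has no divergence, and the Laplacian of a pullback is the
  pullback of the Laplacian (\<open>laplacian_pullback\<close>). Since both Laplacians are compared in bundle
  coordinates lying over the chart that is used downstairs, no coordinate change of the bundle is ever
  differentiated. A function of weight zero is constant along the orbits, which are the fibres, and
  hence is a pullback (\<open>weight_zero_iff\<close>); it is smooth exactly if the function on the surface is
  (\<open>smooth_fun_pullback\<close>). This gives the statement on eigenfunctions.

  The zero set of a pullback is visibly a preimage. For the nodal domains, the projection is a
  continuous open surjection with connected fibres, and for such maps taking preimages is a bijection
  between the connected components (\<open>connected_components_of_eqpoll\<close>); this applies to the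
  restriction of the projection to the complement of the nodal set (\<open>nodal_domains_pullback\<close>).
\<close>

section \<open>Calculus of smooth functions on open sets\<close>

lemma frechet_derivative_eq:
  "(f has_derivative f') (at x) \<Longrightarrow> frechet_derivative f (at x) v = f' v"
  by (metis frechet_derivative_at)

lemma frechet_derivative_cong_open:
  assumes "open S" "x \<in> S" "\<And>y. y \<in> S \<Longrightarrow> f y = g y"
  shows "frechet_derivative f (at x) = frechet_derivative g (at x)"
proof -
  have "(f has_derivative f') (at x) \<longleftrightarrow> (g has_derivative f') (at x)" for f'
    using has_derivative_transform_within_open[OF _ assms(1,2), of f f' UNIV g]
      has_derivative_transform_within_open[OF _ assms(1,2), of g f' UNIV f] assms(3) by auto
  then show ?thesis unfolding frechet_derivative_def by simp
qed

lemma frechet_derivative_has: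
  "f differentiable at x \<Longrightarrow> (f has_derivative frechet_derivative f (at x)) (at x)"
  by (rule iffD1[OF frechet_derivative_works])

lemma times_differentiable_on_cong:
  assumes "open S" "\<And>x. x \<in> S \<Longrightarrow> f x = g x" "times_differentiable_on k S f"
  shows "times_differentiable_on k S g"
  using assms(2,3)
proof (induction k arbitrary: f g)
  case 0
  then show ?case by (metis times_differentiable_on.simps(1) continuous_on_cong)
next
  case (Suc k)
  have fr: "frechet_derivative f (at x) = frechet_derivative g (at x)" if "x \<in> S" for x
    using frechet_derivative_cong_open[OF assms(1) that] Suc.prems(1) by blast
  have "g differentiable at x" if "x \<in> S" for x
  proof -
    have "f differentiable at x" using Suc.prems(2) that by simp
    then show ?thesis
      using has_derivative_transform_within_open[OF _ assms(1) that, of f _ UNIV g] Suc.prems(1)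
      unfolding differentiable_def by blast
  qed
  moreover have "times_differentiable_on k S (\<lambda>x. frechet_derivative g (at x) v)" for v
    by (rule Suc.IH[of "\<lambda>x. frechet_derivative f (at x) v"]) (use fr Suc.prems in auto)
  ultimately show ?case by simp
qed

lemma times_differentiable_on_subset:
  "times_differentiable_on k S f \<Longrightarrow> T \<subseteq> S \<Longrightarrow> times_differentiable_on k T f"
proof (induction k arbitrary: f)
  case 0 then show ?case by (auto intro: continuous_on_subset)
next
  case (Suc k) then show ?case by auto
qed

lemma times_differentiable_on_SucD:
  "times_differentiable_on (Suc k) S f \<Longrightarrow> times_differentiable_on k S f"
proof (induction k arbitrary: f)
  case 0
  then show ?case
    by (auto intro!: continuous_at_imp_continuous_on differentiable_imp_continuous_within)
next
  case (Suc k)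
  show ?case
    unfolding times_differentiable_on.simps(2)[of k]
  proof (intro conjI allI)
    show "\<forall>x\<in>S. f differentiable at x" using Suc.prems by simp
    fix v
    have "times_differentiable_on (Suc k) S (\<lambda>x. frechet_derivative f (at x) v)"
      using Suc.prems unfolding times_differentiable_on.simps(2)[of "Suc k" S f] by blast
    then show "times_differentiable_on k S (\<lambda>x. frechet_derivative f (at x) v)"
      by (rule Suc.IH)
  qed
qed

lemma times_differentiable_on_local:
  assumes "\<And>x. x \<in> S \<Longrightarrow> \<exists>T. open T \<and> x \<in> T \<and> times_differentiable_on k T f"
  shows "times_differentiable_on k S f"
  using assms
proof (induction k arbitrary: f)
  case 0
  have "continuous (at x) f" if "x \<in> S" for x
    using 0[OF that] by (metis times_differentiable_on.simps(1) continuous_on_eq_continuous_at)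
  then show ?case by (simp add: continuous_at_imp_continuous_on)
next
  case (Suc k)
  have "f differentiable at x" if "x \<in> S" for x
    using Suc.prems[OF that] by auto
  moreover have "times_differentiable_on k S (\<lambda>x. frechet_derivative f (at x) v)" for v
    using Suc.prems by (intro Suc.IH) (metis times_differentiable_on.simps(2))
  ultimately show ?case by simp
qed

lemma times_differentiable_on_SucI:
  assumes "open S" "\<And>x. x \<in> S \<Longrightarrow> (f has_derivative f' x) (at x)"
    and "\<And>v. times_differentiable_on k S (\<lambda>x. f' x v)"
  shows "times_differentiable_on (Suc k) S f"
  unfolding times_differentiable_on.simps(2)
proof (intro conjI ballI allI)
  fix x assume "x \<in> S" then show "f differentiable at x"
    using assms(2) unfolding differentiable_def by blast
next
  fix v
  show "times_differentiable_on k S (\<lambda>x. frechet_derivative f (at x) v)"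
    by (rule times_differentiable_on_cong[OF assms(1) _ assms(3)[of v]])
      (simp add: frechet_derivative_eq[OF assms(2)])
qed

lemma times_differentiable_on_derivative:
  assumes "times_differentiable_on (Suc k) S f" "x \<in> S"
  shows "(f has_derivative frechet_derivative f (at x)) (at x)"
  using assms by (auto intro: frechet_derivative_has)

lemma times_differentiable_on_const: "times_differentiable_on k S (\<lambda>x. c)"
proof (induction k arbitrary: c)
  case (Suc k)
  then show ?case by (simp add: frechet_derivative_const)
qed simp

lemma times_differentiable_on_bounded_linear:
  assumes "bounded_linear f" shows "times_differentiable_on k S f"
proof (cases k)
  case 0
  then show ?thesis using assms by (simp add: linear_continuous_on)
next
  case (Suc j)
  have "(f has_derivative f) (at x)" for x
    by (rule bounded_linear_imp_has_derivative[OF assms])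
  then have "frechet_derivative f (at x) = f" for x
    by (simp add: frechet_derivative_at[symmetric])
  then show ?thesis
    using \<open>\<And>x. (f has_derivative f) (at x)\<close> times_differentiable_on_const[of j]
    unfolding Suc times_differentiable_on.simps(2) differentiable_def by auto
qed

lemma times_differentiable_on_add:
  assumes "open S" "times_differentiable_on k S f" "times_differentiable_on k S g"
  shows "times_differentiable_on k S (\<lambda>x. f x + g x)"
  using assms(2,3)
proof (induction k arbitrary: f g)
  case 0 then show ?case by (auto intro: continuous_on_add)
next
  case (Suc k)
  show ?case
  proof (rule times_differentiable_on_SucI[OF assms(1)])
    show "((\<lambda>x. f x + g x) has_derivative
        (\<lambda>v. frechet_derivative f (at x) v + frechet_derivative g (at x) v)) (at x)" if "x \<in> S" for x
      by (rule has_derivative_add[OF times_differentiable_on_derivative[OF Suc.prems(1) that]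
            times_differentiable_on_derivative[OF Suc.prems(2) that]])
    show "times_differentiable_on k S
       (\<lambda>x. frechet_derivative f (at x) v + frechet_derivative g (at x) v)" for v
      by (rule Suc.IH) (use Suc.prems in auto)
  qed
qed

lemma times_differentiable_on_bilinear:
  assumes "bounded_bilinear b" "open S" "times_differentiable_on k S f" "times_differentiable_on k S g"
  shows "times_differentiable_on k S (\<lambda>x. b (f x) (g x))"
  using assms(3,4)
proof (induction k arbitrary: f g)
  case 0 then show ?case by (auto intro: bounded_bilinear.continuous_on[OF assms(1)])
next
  case (Suc k)
  show ?case
  proof (rule times_differentiable_on_SucI[OF assms(2)])
    show "((\<lambda>x. b (f x) (g x)) has_derivative
        (\<lambda>v. b (f x) (frechet_derivative g (at x) v) + b (frechet_derivative f (at x) v) (g x))) (at x)"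
      if "x \<in> S" for x
      by (rule bounded_bilinear.FDERIV[OF assms(1)
            times_differentiable_on_derivative[OF Suc.prems(1) that]
            times_differentiable_on_derivative[OF Suc.prems(2) that]])
    show "times_differentiable_on k S (\<lambda>x. b (f x) (frechet_derivative g (at x) v) +
        b (frechet_derivative f (at x) v) (g x))" for v
    proof (rule times_differentiable_on_add[OF assms(2)])
      show "times_differentiable_on k S (\<lambda>x. b (f x) (frechet_derivative g (at x) v))"
        by (rule Suc.IH[OF times_differentiable_on_SucD[OF Suc.prems(1)]]) (use Suc.prems in simp)
      show "times_differentiable_on k S (\<lambda>x. b (frechet_derivative f (at x) v) (g x))"
        by (rule Suc.IH[OF _ times_differentiable_on_SucD[OF Suc.prems(2)]]) (use Suc.prems in simp)
    qed
  qed
qed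

lemma times_differentiable_on_sum:
  assumes "open S" "finite I" "\<And>i. i \<in> I \<Longrightarrow> times_differentiable_on k S (f i)"
  shows "times_differentiable_on k S (\<lambda>x. \<Sum>i\<in>I. f i x)"
  using assms(2,3)
proof (induction I rule: finite_induct)
  case empty then show ?case by (simp add: times_differentiable_on_const)
next
  case (insert i I)
  then show ?case using times_differentiable_on_add[OF assms(1), of k "f i" "\<lambda>x. \<Sum>i\<in>I. f i x"] by simp
qed

text \<open>In the chain rule the derivative of the outer function is expanded in the standard basis, so
  that only its partial derivatives, at fixed directions, have to be composed with the inner
  function.\<close>

lemma times_differentiable_on_compose:
  fixes f :: "'a::euclidean_space \<Rightarrow> 'b::euclidean_space" and g :: "'b \<Rightarrow> 'c::real_normed_vector"
  assumes "open S" "open T" "f ` S \<subseteq> T"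
    and "times_differentiable_on k S f" "times_differentiable_on k T g"
  shows "times_differentiable_on k S (\<lambda>x. g (f x))"
  using assms(4,5)
proof (induction k arbitrary: g)
  case 0
  then show ?case using assms(3) by (auto intro: continuous_on_compose2)
next
  case (Suc k)
  have f: "times_differentiable_on k S f" by (rule times_differentiable_on_SucD[OF Suc.prems(1)])
  show ?case
  proof (rule times_differentiable_on_SucI[OF assms(1)])
    fix x assume x: "x \<in> S"
    then have fx: "f x \<in> T" using assms(3) by blast
    have g': "(g has_derivative frechet_derivative g (at (f x))) (at (f x))"
      by (rule times_differentiable_on_derivative[OF Suc.prems(2) fx])
    then have lin: "linear (frechet_derivative g (at (f x)))"
      using has_derivative_linear by blast
    have "frechet_derivative g (at (f x)) (frechet_derivative f (at x) v) =
       (\<Sum>b\<in>Basis. (frechet_derivative f (at x) v \<bullet> b) *\<^sub>R frechet_derivative g (at (f x)) b)" for v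
      by (subst euclidean_representation[symmetric, of "frechet_derivative f (at x) v"])
        (simp add: linear_sum[OF lin] linear_scale[OF lin])
    then show "((\<lambda>x. g (f x)) has_derivative (\<lambda>v. \<Sum>b\<in>Basis.
          (frechet_derivative f (at x) v \<bullet> b) *\<^sub>R frechet_derivative g (at (f x)) b)) (at x)"
      using has_derivative_compose[OF times_differentiable_on_derivative[OF Suc.prems(1) x] g']
      by simp
  next
    fix v
    show "times_differentiable_on k S (\<lambda>x. \<Sum>b\<in>Basis.
          (frechet_derivative f (at x) v \<bullet> b) *\<^sub>R frechet_derivative g (at (f x)) b)"
    proof (rule times_differentiable_on_sum[OF assms(1) finite_Basis],
        rule times_differentiable_on_bilinear[OF bounded_bilinear_scaleR assms(1)])
      fix b :: 'b
      show "times_differentiable_on k S (\<lambda>x. frechet_derivative f (at x) v \<bullet> b)"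
        by (rule times_differentiable_on_bilinear[OF bounded_bilinear_inner assms(1)])
          (use Suc.prems times_differentiable_on_const in auto)
      show "times_differentiable_on k S (\<lambda>x. frechet_derivative g (at (f x)) b)"
        by (rule Suc.IH[OF f]) (use Suc.prems in simp)
    qed
  qed
qed

lemma smooth_on_cong:
  "open S \<Longrightarrow> (\<And>x. x \<in> S \<Longrightarrow> f x = g x) \<Longrightarrow> smooth_on S f \<Longrightarrow> smooth_on S g"
  unfolding smooth_on_def using times_differentiable_on_cong by blast

lemma smooth_on_subset: "smooth_on S f \<Longrightarrow> T \<subseteq> S \<Longrightarrow> smooth_on T f"
  unfolding smooth_on_def using times_differentiable_on_subset by blast

lemma smooth_on_local:
  "(\<And>x. x \<in> S \<Longrightarrow> \<exists>T. open T \<and> x \<in> T \<and> smooth_on T f) \<Longrightarrow> smooth_on S f"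
  unfolding smooth_on_def by (intro allI times_differentiable_on_local) blast

lemma smooth_on_const: "smooth_on S (\<lambda>x. c)"
  unfolding smooth_on_def using times_differentiable_on_const by blast

lemma smooth_on_bounded_linear: "bounded_linear f \<Longrightarrow> smooth_on S f"
  unfolding smooth_on_def using times_differentiable_on_bounded_linear by blast

lemma smooth_on_add: "open S \<Longrightarrow> smooth_on S f \<Longrightarrow> smooth_on S g \<Longrightarrow> smooth_on S (\<lambda>x. f x + g x)"
  unfolding smooth_on_def using times_differentiable_on_add by blast

lemma smooth_on_bilinear:
  "bounded_bilinear b \<Longrightarrow> open S \<Longrightarrow> smooth_on S f \<Longrightarrow> smooth_on S g \<Longrightarrow> smooth_on S (\<lambda>x. b (f x) (g x))"
  unfolding smooth_on_def using times_differentiable_on_bilinear by blast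

lemma smooth_on_compose:
  fixes f :: "'a::euclidean_space \<Rightarrow> 'b::euclidean_space"
  shows "open S \<Longrightarrow> open T \<Longrightarrow> f ` S \<subseteq> T \<Longrightarrow> smooth_on S f \<Longrightarrow> smooth_on T g \<Longrightarrow>
    smooth_on S (\<lambda>x. g (f x))"
  unfolding smooth_on_def using times_differentiable_on_compose by blast

lemma smooth_on_differentiable: "smooth_on S f \<Longrightarrow> x \<in> S \<Longrightarrow> f differentiable at x"
  unfolding smooth_on_def using times_differentiable_on.simps(2) by blast

lemma smooth_on_has_derivative:
  "smooth_on S f \<Longrightarrow> x \<in> S \<Longrightarrow> (f has_derivative frechet_derivative f (at x)) (at x)"
  using frechet_derivative_has smooth_on_differentiable by blast

lemma smooth_on_derivative:
  "smooth_on S f \<Longrightarrow> smooth_on S (\<lambda>x. frechet_derivative f (at x) v)"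
  unfolding smooth_on_def using times_differentiable_on.simps(2) by blast

lemma smooth_on_linear_compose:
  fixes f :: "'a::euclidean_space \<Rightarrow> 'b::euclidean_space"
  assumes "bounded_linear l" "open S" "smooth_on S f"
  shows "smooth_on S (\<lambda>x. l (f x))"
  by (rule smooth_on_compose[OF assms(2) open_UNIV _ assms(3) smooth_on_bounded_linear[OF assms(1)]]) simp

lemma smooth_on_mult:
  fixes f g :: "'a::euclidean_space \<Rightarrow> 'b::real_normed_algebra"
  shows "open S \<Longrightarrow> smooth_on S f \<Longrightarrow> smooth_on S g \<Longrightarrow> smooth_on S (\<lambda>x. f x * g x)"
  by (rule smooth_on_bilinear[OF bounded_bilinear_mult])

lemma smooth_on_diff:
  fixes f g :: "'a::euclidean_space \<Rightarrow> 'b::euclidean_space"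
  shows "open S \<Longrightarrow> smooth_on S f \<Longrightarrow> smooth_on S g \<Longrightarrow> smooth_on S (\<lambda>x. f x - g x)"
  using smooth_on_add[OF _ _ smooth_on_linear_compose[OF bounded_linear_minus[OF bounded_linear_ident]],
      of S f g] by simp

lemma smooth_on_Pair:
  fixes f :: "'a::euclidean_space \<Rightarrow> 'b::euclidean_space" and g :: "'a \<Rightarrow> 'c::euclidean_space"
  assumes "open S" "smooth_on S f" "smooth_on S g"
  shows "smooth_on S (\<lambda>x. (f x, g x))"
proof -
  have "smooth_on S (\<lambda>x. (f x, 0) + (0, g x))"
    by (intro smooth_on_add assms smooth_on_linear_compose[OF bounded_linear_Pair, of "\<lambda>x. x" "\<lambda>x. 0"]
        smooth_on_linear_compose[OF bounded_linear_Pair, of "\<lambda>x. 0" "\<lambda>x. x"]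
        bounded_linear_ident bounded_linear_zero)
  then show ?thesis by simp
qed

text \<open>Square roots and reciprocals are real powers; scaled powers \<open>c * x powr a\<close>, like the functions
  \<open>c * cis x\<close>, form a family closed under differentiation, so that the order of differentiability
  can be raised by induction.\<close>

lemma times_differentiable_on_powr: "times_differentiable_on k {0<..} (\<lambda>x::real. c * x powr a)"
proof (induction k arbitrary: c a)
  case 0
  then show ?case by (auto intro!: continuous_intros)
next
  case (Suc k)
  show ?case
  proof (rule times_differentiable_on_SucI)
    fix x :: real assume "x \<in> {0<..}"
    then show "((\<lambda>x. c * x powr a) has_derivative (\<lambda>v. (v * c * a) * x powr (a - 1))) (at x)"
      by (auto intro!: derivative_eq_intros simp: powr_diff field_simps)
  qed (use Suc in auto)
qed

lemma smooth_on_powr: "smooth_on {0<..} (\<lambda>x::real. x powr a)"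
  unfolding smooth_on_def using times_differentiable_on_powr[of _ 1 a] by simp

lemma smooth_on_sqrt: "smooth_on {0<..} sqrt"
  by (rule smooth_on_cong[OF _ _ smooth_on_powr[of "1/2"]]) (auto simp: powr_half_sqrt)

lemma smooth_on_inverse: "smooth_on {0<..} (\<lambda>x::real. inverse x)"
  by (rule smooth_on_cong[OF _ _ smooth_on_powr[of "-1"]]) (auto simp: powr_minus)

lemma times_differentiable_on_cis: "times_differentiable_on k UNIV (\<lambda>x. c * cis x)"
proof (induction k arbitrary: c)
  case 0
  then show ?case by (auto intro!: continuous_intros simp: cis_conv_exp)
next
  case (Suc k)
  show ?case
  proof (rule times_differentiable_on_SucI)
    fix x :: real
    show "((\<lambda>x. c * cis x) has_derivative (\<lambda>v. (of_real v * c * \<i>) * cis x)) (at x)"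
      by (auto intro!: derivative_eq_intros simp: algebra_simps scaleR_conv_of_real)
  qed (use Suc in auto)
qed

lemma smooth_on_cis: "smooth_on UNIV cis"
  unfolding smooth_on_def using times_differentiable_on_cis[of _ 1] by simp

lemma holomorphic_imp_smooth_on:
  assumes "open S" "f holomorphic_on S" shows "smooth_on S f"
proof -
  have "times_differentiable_on k S f" if "f holomorphic_on S" for k f
    using that
  proof (induction k arbitrary: f)
    case 0 then show ?case by (simp add: holomorphic_on_imp_continuous_on)
  next
    case (Suc k)
    show ?case
    proof (rule times_differentiable_on_SucI[OF assms(1)])
      show "(f has_derivative (\<lambda>v. deriv f x * v)) (at x)" if "x \<in> S" for x
        using holomorphic_derivI[OF Suc.prems assms(1) that] by (simp add: has_field_derivative_def)
      show "times_differentiable_on k S (\<lambda>x. deriv f x * v)" for v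
        by (rule Suc.IH) (intro holomorphic_intros Suc.prems assms(1))
    qed
  qed
  then show ?thesis using assms unfolding smooth_on_def by blast
qed

section \<open>Charts, topology and tangent vectors\<close>

lemma chart_inv_left: "inj_on (snd c) (fst c) \<Longrightarrow> x \<in> fst c \<Longrightarrow> chart_inv c (snd c x) = x"
  unfolding chart_inv_def by (rule inv_into_f_f)

lemma chart_inv_right: "y \<in> snd c ` fst c \<Longrightarrow> snd c (chart_inv c y) = y"
  unfolding chart_inv_def by (rule f_inv_into_f)

lemma chart_inv_in: "y \<in> snd c ` fst c \<Longrightarrow> chart_inv c y \<in> fst c"
  unfolding chart_inv_def by (rule inv_into_into)

lemma chart_image_eq:
  "inj_on (snd c) (fst c) \<Longrightarrow> chart_image c W = {y \<in> snd c ` fst c. chart_inv c y \<in> W}"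
  unfolding chart_image_def by (auto simp: chart_inv_left chart_inv_right chart_inv_in intro!: image_eqI)

lemma chart_image_inv:
  "inj_on (snd c) (fst c) \<Longrightarrow> y \<in> chart_image c W \<Longrightarrow> chart_inv c y \<in> W"
  by (simp add: chart_image_eq)

lemma chart_image_fst: "chart_image c (fst c) = snd c ` fst c"
  unfolding chart_image_def by simp

lemma chart_image_carrier: "c \<in> A \<Longrightarrow> chart_image c (carrier_of A) = snd c ` fst c"
  unfolding chart_image_def carrier_of_def by auto

text \<open>Everything that concerns one chart at a time only needs the following part of the atlas
  axioms; on the circle bundle this avoids any discussion of coordinate changes.\<close>

definition open_charts :: "('a, 'e::euclidean_space) chart set \<Rightarrow> bool" where
  "open_charts A \<longleftrightarrow> (\<forall>c\<in>A. inj_on (snd c) (fst c) \<and> open (snd c ` fst c))"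

lemma open_charts_inj: "open_charts A \<Longrightarrow> c \<in> A \<Longrightarrow> inj_on (snd c) (fst c)"
  unfolding open_charts_def by blast

lemma open_charts_open: "open_charts A \<Longrightarrow> c \<in> A \<Longrightarrow> open (snd c ` fst c)"
  unfolding open_charts_def by blast

lemma openin_open_charts:
  assumes "open_charts A"
  shows "openin (atlas_topology A) W \<longleftrightarrow> W \<subseteq> carrier_of A \<and> (\<forall>c\<in>A. open (chart_image c W))"
  using assms by (auto simp: openin_atlas_topology chart_image_eq open_charts_inj)

lemma openin_chart_image:
  "open_charts A \<Longrightarrow> openin (atlas_topology A) W \<Longrightarrow> c \<in> A \<Longrightarrow> open (chart_image c W)"
  by (simp add: openin_open_charts)

lemma topspace_atlas_topology:
  assumes "open_charts A" shows "topspace (atlas_topology A) = carrier_of A"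
proof
  show "topspace (atlas_topology A) \<subseteq> carrier_of A"
    using openin_topspace[of "atlas_topology A"] by (simp only: openin_atlas_topology)
  have "openin (atlas_topology A) (carrier_of A)"
    using assms by (simp add: openin_open_charts chart_image_carrier open_charts_open)
  then show "carrier_of A \<subseteq> topspace (atlas_topology A)" by (rule openin_subset)
qed

lemma smooth_fun_subset: "smooth_fun A W f \<Longrightarrow> V \<subseteq> W \<Longrightarrow> smooth_fun A V f"
  unfolding smooth_fun_def chart_image_def by (blast intro: smooth_on_subset)

lemma smooth_fun_cong:
  assumes "open_charts A" "openin (atlas_topology A) W" "\<And>z. z \<in> W \<Longrightarrow> f z = f' z" "smooth_fun A W f"
  shows "smooth_fun A W f'"
  unfolding smooth_fun_def
proof
  fix c assume c: "c \<in> A"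
  show "smooth_on (chart_image c W) (f' \<circ> chart_inv c)"
    by (rule smooth_on_cong[of _ "f \<circ> chart_inv c", OF openin_chart_image[OF assms(1,2) c]])
      (use assms(3,4) c chart_image_inv[OF open_charts_inj[OF assms(1) c]] in \<open>auto simp: smooth_fun_def\<close>)
qed

lemma smooth_fun_compose:
  fixes f :: "'a \<Rightarrow> 'b::euclidean_space"
  assumes "open_charts A" "openin (atlas_topology A) W" "smooth_fun A W f"
    and "open T" "f ` W \<subseteq> T" "smooth_on T F"
  shows "smooth_fun A W (\<lambda>z. F (f z))"
  unfolding smooth_fun_def
proof
  fix c assume c: "c \<in> A"
  have "smooth_on (chart_image c W) (f \<circ> chart_inv c)" using assms(3) c by (simp add: smooth_fun_def)
  moreover have "(f \<circ> chart_inv c) ` chart_image c W \<subseteq> T"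
    using assms(5) chart_image_inv[OF open_charts_inj[OF assms(1) c]] by fastforce
  ultimately have "smooth_on (chart_image c W) (\<lambda>y. F ((f \<circ> chart_inv c) y))"
    by (intro smooth_on_compose[OF openin_chart_image[OF assms(1,2) c] assms(4) _ _ assms(6)])
  then show "smooth_on (chart_image c W) ((\<lambda>z. F (f z)) \<circ> chart_inv c)" by (simp add: comp_def)
qed

lemma smooth_fun_linear:
  fixes f :: "'a \<Rightarrow> 'b::euclidean_space"
  assumes "open_charts A" "openin (atlas_topology A) W" "smooth_fun A W f" "bounded_linear l"
  shows "smooth_fun A W (\<lambda>z. l (f z))"
  by (rule smooth_fun_compose[OF assms(1-3) open_UNIV _ smooth_on_bounded_linear[OF assms(4)]]) simp

lemma smooth_fun_bilinear:
  assumes "bounded_bilinear b" "open_charts A" "openin (atlas_topology A) W" "smooth_fun A W f" "smooth_fun A W f'"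
  shows "smooth_fun A W (\<lambda>z. b (f z) (f' z))"
  using assms smooth_on_bilinear[OF assms(1)] openin_chart_image[OF assms(2,3)]
  unfolding smooth_fun_def comp_def by blast

lemma smooth_fun_const: "smooth_fun A W (\<lambda>z. k)"
  unfolding smooth_fun_def comp_def by (simp add: smooth_on_const)

lemma smooth_nearI: "openin (atlas_topology A) W \<Longrightarrow> x \<in> W \<Longrightarrow> smooth_fun A W f \<Longrightarrow> smooth_near A x f"
  unfolding smooth_near_def by blast

lemma smooth_near_differentiable:
  assumes "open_charts A" "c \<in> A" "x \<in> fst c" "smooth_near A x f"
  shows "(f \<circ> chart_inv c) differentiable at (snd c x)"
proof -
  obtain W where W: "x \<in> W" "smooth_fun A W f" using assms(4) unfolding smooth_near_def by blast
  show ?thesis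
    by (rule smooth_on_differentiable[of "chart_image c W"])
      (use W assms in \<open>auto simp: smooth_fun_def chart_image_def\<close>)
qed

lemma linear_tangent_vector:
  assumes "open_charts A" "c \<in> A" "x \<in> fst c"
  shows "linear (\<lambda>v. tangent_vector A c x v f)"
proof (cases "smooth_near A x f")
  case True
  then show ?thesis
    using has_derivative_linear[OF frechet_derivative_has[OF smooth_near_differentiable[OF assms True]]]
    by (simp add: tangent_vector_def)
next
  case False
  then show ?thesis by (simp add: tangent_vector_def linear_zero)
qed

lemma tangent_vector_add:
  assumes "open_charts A" "c \<in> A" "x \<in> fst c"
  shows "tangent_vector A c x (v + w) = tangent_add (tangent_vector A c x v) (tangent_vector A c x w)"
  unfolding tangent_add_def using linear_add[OF linear_tangent_vector[OF assms]] by fast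

lemma tangent_vector_scale:
  assumes "open_charts A" "c \<in> A" "x \<in> fst c"
  shows "tangent_vector A c x (r *\<^sub>R v) = tangent_scale r (tangent_vector A c x v)"
  unfolding tangent_scale_def using linear_scale[OF linear_tangent_vector[OF assms]] by fastforce

lemma tangent_vector_in: "c \<in> A \<Longrightarrow> x \<in> fst c \<Longrightarrow> tangent_vector A c x v \<in> tangent_space A x"
  unfolding tangent_space_def by blast

lemma complex_derivative_tangent_vector:
  assumes "open_charts A" "c \<in> A" "x \<in> fst c" "openin (atlas_topology A) W" "x \<in> W" "smooth_fun A W f"
  shows "complex_derivative (tangent_vector A c x v) f =
    frechet_derivative (f \<circ> chart_inv c) (at (snd c x)) v"
proof -
  have near: "smooth_near A x (\<lambda>z. Re (f z))" "smooth_near A x (\<lambda>z. Im (f z))"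
    using smooth_nearI[OF assms(4,5)] smooth_fun_linear[OF assms(1,4,6)] bounded_linear_Re bounded_linear_Im
    by blast+
  have D: "((f \<circ> chart_inv c) has_derivative frechet_derivative (f \<circ> chart_inv c) (at (snd c x))) (at (snd c x))"
    by (rule frechet_derivative_has[OF smooth_near_differentiable[OF assms(1-3) smooth_nearI[OF assms(4-6)]]])
  have "frechet_derivative ((\<lambda>z. Re (f z)) \<circ> chart_inv c) (at (snd c x)) v =
      Re (frechet_derivative (f \<circ> chart_inv c) (at (snd c x)) v)"
    "frechet_derivative ((\<lambda>z. Im (f z)) \<circ> chart_inv c) (at (snd c x)) v =
      Im (frechet_derivative (f \<circ> chart_inv c) (at (snd c x)) v)"
    using has_derivative_Re[OF D] has_derivative_Im[OF D]
    by (simp_all add: comp_def frechet_derivative_eq)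
  then show ?thesis
    using near by (simp add: complex_derivative_def tangent_vector_def complex_eq_iff)
qed

lemma complex_atlas_open_charts: "complex_atlas A \<Longrightarrow> open_charts A"
  unfolding complex_atlas_def open_charts_def using chart_image_fst by metis

lemma complex_atlas_transition:
  "complex_atlas A \<Longrightarrow> c \<in> A \<Longrightarrow> c' \<in> A \<Longrightarrow> smooth_on (chart_image c (fst c')) (snd c' \<circ> chart_inv c)"
  unfolding complex_atlas_def by (blast intro: holomorphic_imp_smooth_on)

lemma complex_atlas_openin_chart:
  "complex_atlas A \<Longrightarrow> c \<in> A \<Longrightarrow> openin (atlas_topology A) (fst c)"
  unfolding openin_open_charts[OF complex_atlas_open_charts] by (auto simp: complex_atlas_def carrier_of_def)

lemma complex_atlas_smooth_chart:
  "complex_atlas A \<Longrightarrow> c \<in> A \<Longrightarrow> smooth_fun A (fst c) (snd c)"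
  unfolding smooth_fun_def using complex_atlas_transition by blast

lemma complex_atlas_smooth_fun_chart:
  fixes F :: "complex \<Rightarrow> 'b::real_normed_vector"
  assumes "complex_atlas A" "c \<in> A" "open T" "smooth_on T F" "openin (atlas_topology A) W" "W \<subseteq> fst c"
    "snd c ` W \<subseteq> T"
  shows "smooth_fun A W (\<lambda>z. F (snd c z))"
  by (rule smooth_fun_compose[OF complex_atlas_open_charts[OF assms(1)] assms(5)
        smooth_fun_subset[OF complex_atlas_smooth_chart[OF assms(1,2)] assms(6)] assms(3) assms(7) assms(4)])

lemma holomorphic_fun_smooth:
  "open_charts A \<Longrightarrow> openin (atlas_topology A) W \<Longrightarrow> holomorphic_fun A W f \<Longrightarrow> smooth_fun A W f"
  unfolding holomorphic_fun_def smooth_fun_def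
  by (blast intro: holomorphic_imp_smooth_on openin_chart_image)

text \<open>A non-zero coordinate vector is detected by the corresponding linear coordinate function.\<close>

lemma tangent_vector_nonzero:
  assumes A: "complex_atlas A" and c: "c \<in> A" "x \<in> fst c" and "v \<noteq> 0"
  shows "tangent_vector A c x v \<noteq> (\<lambda>_. 0)"
proof -
  note oc = complex_atlas_open_charts[OF A]
  let ?f = "\<lambda>z. snd c z \<bullet> v"
  have "smooth_near A x ?f"
    by (rule smooth_nearI[OF complex_atlas_openin_chart[OF A c(1)] c(2)],
        rule complex_atlas_smooth_fun_chart[OF A c(1) open_UNIV])
      (use c in \<open>auto intro!: smooth_on_bounded_linear bounded_linear_inner_left complex_atlas_openin_chart[OF A]\<close>)
  moreover have "frechet_derivative (?f \<circ> chart_inv c) (at (snd c x)) v = v \<bullet> v"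
  proof -
    have e: "frechet_derivative (?f \<circ> chart_inv c) (at (snd c x)) = frechet_derivative (\<lambda>y. y \<bullet> v) (at (snd c x))"
      by (rule frechet_derivative_cong_open[OF open_charts_open[OF oc c(1)]])
        (use c in \<open>auto simp: chart_inv_left[OF open_charts_inj[OF oc]]\<close>)
    show ?thesis unfolding e
      by (rule frechet_derivative_eq[OF bounded_linear_imp_has_derivative[OF bounded_linear_inner_left]])
  qed
  ultimately have "tangent_vector A c x v ?f = v \<bullet> v" by (simp add: tangent_vector_def)
  then show ?thesis using \<open>v \<noteq> 0\<close> by (metis inner_eq_zero_iff)
qed

lemma metric_in_chart_sym:
  assumes "riemannian_metric A g" "c \<in> A" "y \<in> snd c ` fst c"
  shows "metric_in_chart A g c y v w = metric_in_chart A g c y w v"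
  using assms chart_inv_in[OF assms(3)] tangent_vector_in[OF assms(2)]
  unfolding riemannian_metric_def metric_in_chart_def carrier_of_def by blast

lemma linear_metric_in_chart:
  assumes "riemannian_metric A g" "open_charts A" "c \<in> A" "y \<in> snd c ` fst c"
  shows "linear (\<lambda>v. metric_in_chart A g c y v w)"
proof -
  let ?x = "chart_inv c y"
  have x: "?x \<in> fst c" "?x \<in> carrier_of A" using chart_inv_in[OF assms(4)] assms(3) by (auto simp: carrier_of_def)
  note t = tangent_vector_in[OF assms(3) x(1)]
  show ?thesis
  proof (rule linearI)
    fix v v' show "metric_in_chart A g c y (v + v') w = metric_in_chart A g c y v w + metric_in_chart A g c y v' w"
      using assms(1) t x(2) unfolding riemannian_metric_def metric_in_chart_def
        tangent_vector_add[OF assms(2,3) x(1)] by blast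
    fix r show "metric_in_chart A g c y (r *\<^sub>R v) w = r *\<^sub>R metric_in_chart A g c y v w"
      using assms(1) t x(2) unfolding riemannian_metric_def metric_in_chart_def
        tangent_vector_scale[OF assms(2,3) x(1)] by simp
  qed
qed

lemma metric_in_chart_pos:
  assumes "riemannian_metric A g" "complex_atlas A" "c \<in> A" "y \<in> snd c ` fst c" "v \<noteq> 0"
  shows "metric_in_chart A g c y v v > 0"
  using assms(1) tangent_vector_nonzero[OF assms(2,3) chart_inv_in[OF assms(4)] assms(5)]
    tangent_vector_in[OF assms(3) chart_inv_in[OF assms(4)]] assms(3) chart_inv_in[OF assms(4)]
  unfolding riemannian_metric_def metric_in_chart_def carrier_of_def by blast

lemma smooth_on_metric_in_chart:
  "riemannian_metric A g \<Longrightarrow> c \<in> A \<Longrightarrow> smooth_on (snd c ` fst c) (\<lambda>y. metric_in_chart A g c y v w)"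
  unfolding riemannian_metric_def by blast

section \<open>Preimages of connected components\<close>

text \<open>For an open map with connected fibres the preimage of a connected set is connected. Hence the
  component of a point is the whole preimage of the component of its image.\<close>

lemma connected_components_of_eqpoll:
  assumes f: "continuous_map X Y f" "open_map X Y f" "f ` topspace X = topspace Y" "monotone_map X Y f"
  shows "connected_components_of X \<approx> connected_components_of Y"
proof -
  let ?pre = "\<lambda>C. {x \<in> topspace X. f x \<in> C}"
  have comp: "connected_component_of_set X x = ?pre (connected_component_of_set Y (f x))"
    if x: "x \<in> topspace X" for x
  proof
    have "connectedin Y (f ` connected_component_of_set X x)"
      by (rule connectedin_continuous_map_image[OF f(1) connectedin_connected_component_of])
    moreover have "f x \<in> f ` connected_component_of_set X x"
      using x by (auto simp: connected_component_of_refl)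
    ultimately have "f ` connected_component_of_set X x \<subseteq> connected_component_of_set Y (f x)"
      by (rule connected_component_of_maximal)
    then show "connected_component_of_set X x \<subseteq> ?pre (connected_component_of_set Y (f x))"
      using connected_component_of_subset_topspace[of X x] by blast
    have "connectedin X (?pre (connected_component_of_set Y (f x)))"
      by (rule monotone_open_map[OF f(1-3), THEN iffD1, OF f(4), rule_format,
            OF connectedin_connected_component_of])
    moreover have "x \<in> ?pre (connected_component_of_set Y (f x))"
      using x f(3) by (auto simp: connected_component_of_refl)
    ultimately show "?pre (connected_component_of_set Y (f x)) \<subseteq> connected_component_of_set X x"
      by (rule connected_component_of_maximal)
  qed
  have "f ` ?pre C = C" if "C \<in> connected_components_of Y" for C
    using connected_components_of_subset[OF that] f(3) by auto
  then have "inj_on ?pre (connected_components_of Y)" by (rule inj_on_inverseI)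
  moreover have "?pre ` connected_components_of Y = connected_components_of X"
    unfolding connected_components_of_def f(3)[symmetric] image_image using comp by (simp cong: image_cong)
  ultimately have "bij_betw ?pre (connected_components_of Y) (connected_components_of X)"
    by (simp add: bij_betw_def)
  then have "connected_components_of Y \<approx> connected_components_of X" unfolding eqpoll_def by blast
  then show ?thesis by (rule eqpoll_sym)
qed

section \<open>Linear algebra of the metrics\<close>

lemma gram_det_complex:
  fixes m :: "complex \<Rightarrow> complex \<Rightarrow> real"
  shows "gram_det m = m 1 1 * m \<i> \<i> - m 1 \<i> * m \<i> 1"
proof -
  have f: "finite {\<i>}" "1 \<notin> {\<i>}" by auto
  show ?thesis
    unfolding gram_det_def Basis_complex_def
    unfolding sum_over_permutations_insert[OF f] permutes_sing
    by (simp add: sign_swap_id sign_id)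
qed

lemma Basis_complex_real: "(Basis :: (complex \<times> real) set) = {(1, 0), (\<i>, 0), (0, 1)}"
  unfolding Basis_prod_def by (auto simp: Basis_complex_def)

lemma gram_det_complex_real:
  fixes B :: "complex \<times> real \<Rightarrow> complex \<times> real \<Rightarrow> real"
  defines "a \<equiv> (1, 0)" and "b \<equiv> (\<i>, 0)" and "c \<equiv> (0, 1)"
  shows "gram_det B = B a a * B b b * B c c + B a b * B b c * B c a + B a c * B b a * B c b
    - B a a * B b c * B c b - B a b * B b a * B c c - B a c * B b b * B c a"
proof -
  have ne: "a \<noteq> b" "a \<noteq> c" "b \<noteq> c" "b \<noteq> a" "c \<noteq> a" "c \<noteq> b" by (auto simp: a_def b_def c_def)
  have f: "finite {b, c}" "a \<notin> {b, c}" and g: "finite {c}" "b \<notin> {c}" using ne by auto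
  have e: "(Basis :: (complex \<times> real) set) = {a, b, c}"
    by (simp add: Basis_complex_real a_def b_def c_def)
  show ?thesis
    unfolding gram_det_def e
    unfolding sum_over_permutations_insert[OF f] sum_over_permutations_insert[OF g] permutes_sing
    using ne
    by (simp add: sign_swap_id permutation_swap_id sign_compose sign_id transpose_apply_other)
qed

text \<open>The gradient is defined as a unique solution of linear equations. Cramer's rule makes it a
  rational expression in the coefficients of the metric, which is how its smoothness is obtained.\<close>

definition cramer :: "(complex \<Rightarrow> complex \<Rightarrow> real) \<Rightarrow> (complex \<Rightarrow> real) \<Rightarrow> complex" where
  "cramer m l = Complex ((l 1 * m \<i> \<i> - l \<i> * m 1 \<i>) * inverse (gram_det m))
                        ((l \<i> * m 1 1 - l 1 * m 1 \<i>) * inverse (gram_det m))"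

locale planar_inner_product =
  fixes m :: "complex \<Rightarrow> complex \<Rightarrow> real"
  assumes lin: "\<And>w. linear (\<lambda>v. m v w)" and sym: "\<And>v w. m v w = m w v"
    and pos: "\<And>v. v \<noteq> 0 \<Longrightarrow> m v v > 0"
begin

lemma expand: "m v w = Re v * m 1 w + Im v * m \<i> w"
proof -
  have "v = Re v *\<^sub>R 1 + Im v *\<^sub>R \<i>" by (simp add: complex_eq_iff)
  then have "m v w = m (Re v *\<^sub>R 1 + Im v *\<^sub>R \<i>) w" by simp
  then show ?thesis using linear_add[OF lin] linear_scale[OF lin] by simp
qed

lemma gram_det_pos: "gram_det m > 0"
proof -
  \<comment> \<open>\<open>?v\<close> is \<open>m\<close>-orthogonal to \<open>1\<close>, so its square length carries the determinant.\<close>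
  let ?v = "Complex (m 1 \<i>) (- m 1 1)"
  have p: "m 1 1 > 0" using pos by simp
  then have "?v \<noteq> 0" by (simp add: complex_eq_iff)
  then have "m ?v ?v > 0" by (rule pos)
  moreover have "m ?v ?v = m 1 1 * gram_det m"
    by (simp add: gram_det_complex expand[of ?v] sym[of 1 ?v] sym[of \<i> ?v] expand[of ?v 1] expand[of ?v \<i>]
        sym[of \<i> 1] algebra_simps)
  ultimately show ?thesis using p by (simp add: zero_less_mult_iff)
qed

lemma cramer_iff:
  assumes "linear l"
  shows "(\<forall>v. m u v = l v) \<longleftrightarrow> u = cramer m l"
proof -
  let ?d = "gram_det m"
  have l: "l v = Re v * l 1 + Im v * l \<i>" for v
  proof -
    have "v = Re v *\<^sub>R 1 + Im v *\<^sub>R \<i>" by (simp add: complex_eq_iff)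
    then have "l v = l (Re v *\<^sub>R 1 + Im v *\<^sub>R \<i>)" by simp
    then show ?thesis using linear_add[OF assms] linear_scale[OF assms] by simp
  qed
  have "(\<forall>v. m u v = l v) \<longleftrightarrow> m u 1 = l 1 \<and> m u \<i> = l \<i>"
  proof safe
    fix v assume "m u 1 = l 1" "m u \<i> = l \<i>"
    then show "m u v = l v" using expand[of v u] l[of v] sym by metis
  qed auto
  also have "\<dots> \<longleftrightarrow> Re u * m 1 1 + Im u * m 1 \<i> = l 1 \<and> Re u * m 1 \<i> + Im u * m \<i> \<i> = l \<i>"
    by (simp add: expand[of u] sym[of \<i> 1])
  also have "\<dots> \<longleftrightarrow> Re u * ?d = l 1 * m \<i> \<i> - l \<i> * m 1 \<i> \<and> Im u * ?d = l \<i> * m 1 1 - l 1 * m 1 \<i>"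
    (is "?a \<longleftrightarrow> ?b")
  proof
    assume ?a
    then have l1: "l 1 = Re u * m 1 1 + Im u * m 1 \<i>" and li: "l \<i> = Re u * m 1 \<i> + Im u * m \<i> \<i>" by simp_all
    show ?b unfolding gram_det_complex sym[of \<i> 1] l1 li by (simp add: algebra_simps)
  next
    assume b: ?b
    have "(Re u * m 1 1 + Im u * m 1 \<i>) * ?d = m 1 1 * (Re u * ?d) + m 1 \<i> * (Im u * ?d)"
      by (simp add: algebra_simps)
    also have "\<dots> = l 1 * ?d"
      using b unfolding gram_det_complex sym[of \<i> 1] by (simp only:) (simp add: algebra_simps)
    finally have 1: "Re u * m 1 1 + Im u * m 1 \<i> = l 1" using gram_det_pos by simp
    have "(Re u * m 1 \<i> + Im u * m \<i> \<i>) * ?d = m 1 \<i> * (Re u * ?d) + m \<i> \<i> * (Im u * ?d)"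
      by (simp add: algebra_simps)
    also have "\<dots> = l \<i> * ?d"
      using b unfolding gram_det_complex sym[of \<i> 1] by (simp only:) (simp add: algebra_simps)
    finally show ?a using 1 gram_det_pos by simp
  qed
  also have "\<dots> \<longleftrightarrow> u = cramer m l"
  proof -
    have "x * ?d = y \<longleftrightarrow> x = y * inverse ?d" for x y
      using gram_det_pos by (auto simp: field_simps)
    then show ?thesis by (simp add: cramer_def complex_eq_iff)
  qed
  finally show ?thesis .
qed

text \<open>The Kaluza-Klein form of a metric in a local trivialization: \<open>\<beta>\<close> is the local connection
  form. Its Gram matrix arises from the block sum of \<open>m\<close> and \<open>1\<close> by a unipotent change of basis.\<close>

lemma gram_det_kaluza_klein:
  assumes "linear \<beta>"
    and M: "\<And>v r v' r'. M (v, r) (v', r') = m v v' + (r - \<beta> v) * (r' - \<beta> v')"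
  shows "gram_det M = gram_det m"
proof -
  have z: "m 0 v = 0" "m v 0 = 0" for v using linear_0[OF lin, of v] sym[of v 0] by simp_all
  show ?thesis
    unfolding gram_det_complex_real gram_det_complex M z linear_0[OF assms(1)] sym[of \<i> 1]
    by (simp add: algebra_simps)
qed

text \<open>Vertical test vectors force the vertical component of the solution to be \<open>\<beta>\<close> of the horizontal
  one; after that the second summand vanishes and the equation for \<open>m\<close> is left.\<close>

lemma kaluza_klein_gradient_iff:
  assumes "linear \<beta>" "linear l"
    and M: "\<And>v r v' r'. M (v, r) (v', r') = m v v' + (r - \<beta> v) * (r' - \<beta> v')"
  shows "(\<forall>q. M p q = l (fst q)) \<longleftrightarrow> p = (cramer m l, \<beta> (cramer m l))"
proof -
  obtain u s where p: "p = (u, s)" by (cases p)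
  have "(\<forall>q. M p q = l (fst q)) \<longleftrightarrow> (\<forall>v r. m u v + (s - \<beta> u) * (r - \<beta> v) = l v)"
    unfolding p by (simp add: split_paired_All M)
  also have "\<dots> \<longleftrightarrow> (\<forall>v. m u v = l v) \<and> s = \<beta> u"
  proof safe
    assume a: "\<forall>v r. m u v + (s - \<beta> u) * (r - \<beta> v) = l v"
    show "m u v = l v" for v using a[rule_format, of v "\<beta> v"] by simp
    show "s = \<beta> u" using a[rule_format, of 0 1] a[rule_format, of 0 0] linear_0[OF assms(1)] by simp
  qed auto
  also have "\<dots> \<longleftrightarrow> p = (cramer m l, \<beta> (cramer m l))"
    unfolding cramer_iff[OF assms(2)] p by auto
  finally show ?thesis .
qed

end

section \<open>Coordinates on the circle bundle\<close>

lemma Arg_polar: "0 < r \<Longrightarrow> - pi < t \<Longrightarrow> t \<le> pi \<Longrightarrow> Arg (of_real r * cis t) = t"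
  by (rule Arg_unique[of r]) (auto simp: cis_conv_exp)

lemma polar_Arg: "of_real (cmod z) * cis (Arg z) = z"
  by (cases "z = 0") (use Arg_eq[of z] in \<open>auto simp: cis_conv_exp\<close>)

lemma Arg_less_pi_iff: "Arg z < pi \<longleftrightarrow> z \<notin> \<real>\<^sub>\<le>\<^sub>0 \<or> z = 0"
  using Arg_le_pi[of z] Arg_eq_pi[of z] pi_gt_zero Arg_zero
  by (auto simp: complex_nonpos_Reals_iff less_le complex_eq_iff)

locale hermitian_line_bundle =
  fixes A :: "('x, complex) chart set" and L :: "('x, 'l) line_bundle"
    and h :: "'x \<Rightarrow> 'l \<Rightarrow> 'l \<Rightarrow> complex"
  assumes A: "complex_atlas A" and L: "holomorphic_line_bundle A L" and h: "hermitian_metric A L h"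
begin

abbreviation "frame T z \<equiv> unit_frame L (snd T) z"

definition frame_norm :: "('x set \<times> ('x \<Rightarrow> 'l \<Rightarrow> complex)) \<Rightarrow> 'x \<Rightarrow> real" where
  "frame_norm T z = sqrt (Re (h z (frame T z) (frame T z)))"

text \<open>The unit covector over \<open>z\<close> whose value on the frame has the phase \<open>w\<close>.\<close>

definition circle_point :: "('x set \<times> ('x \<Rightarrow> 'l \<Rightarrow> complex)) \<Rightarrow> 'x \<Rightarrow> complex \<Rightarrow> 'x \<times> ('l \<Rightarrow> complex)" where
  "circle_point T z w =
     (z, \<lambda>u. if u \<in> fibre L z then of_real (frame_norm T z) * w * snd T z u else 0)"

lemmas open_A = complex_atlas_open_charts[OF A]

lemmas line_bundle = L[unfolded holomorphic_line_bundle_def case_prod_unfold]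
lemmas fibre_closed = line_bundle[THEN conjunct1]
lemmas trivializations_cover = line_bundle[THEN conjunct2, THEN conjunct1]
lemmas trivialization_iso = line_bundle[THEN conjunct2, THEN conjunct2, THEN conjunct1, THEN bspec]
lemmas trivializations_holomorphic =
  line_bundle[THEN conjunct2, THEN conjunct2, THEN conjunct2, THEN bspec, THEN bspec]
lemmas hermitian = h[unfolded hermitian_metric_def, THEN conjunct1, THEN bspec, THEN bspec]

lemma ex_trivialization: "z \<in> carrier_of A \<Longrightarrow> \<exists>T\<in>trivializations L. z \<in> fst T"
  unfolding trivializations_cover by blast

lemma trivialization_openin: "T \<in> trivializations L \<Longrightarrow> openin (atlas_topology A) (fst T)"
  by (drule trivialization_iso) blast

lemma trivialization_carrier: "T \<in> trivializations L \<Longrightarrow> fst T \<subseteq> carrier_of A"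
  unfolding trivializations_cover by blast

lemma trivialization_bij: "T \<in> trivializations L \<Longrightarrow> z \<in> fst T \<Longrightarrow> bij_betw (snd T z) (fibre L z) UNIV"
  by (drule trivialization_iso) blast

lemma trivialization_add:
  "T \<in> trivializations L \<Longrightarrow> z \<in> fst T \<Longrightarrow> u \<in> fibre L z \<Longrightarrow> v \<in> fibre L z \<Longrightarrow>
    snd T z (fibre_add L z u v) = snd T z u + snd T z v"
  by (drule trivialization_iso) blast

lemma trivialization_scale:
  "T \<in> trivializations L \<Longrightarrow> z \<in> fst T \<Longrightarrow> u \<in> fibre L z \<Longrightarrow> snd T z (fibre_scale L z a u) = a * snd T z u"
  by (drule trivialization_iso) blast

lemma fibre_add_in:
  "z \<in> carrier_of A \<Longrightarrow> u \<in> fibre L z \<Longrightarrow> v \<in> fibre L z \<Longrightarrow> fibre_add L z u v \<in> fibre L z"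
  using fibre_closed by blast

lemma fibre_scale_in: "z \<in> carrier_of A \<Longrightarrow> u \<in> fibre L z \<Longrightarrow> fibre_scale L z a u \<in> fibre L z"
  using fibre_closed by blast

lemma trivialization_transition:
  assumes "T \<in> trivializations L" "T' \<in> trivializations L"
  obtains t where "smooth_fun A (fst T \<inter> fst T') t"
    "\<And>z u. z \<in> fst T \<inter> fst T' \<Longrightarrow> u \<in> fibre L z \<Longrightarrow> snd T' z u = t z * snd T z u"
proof -
  obtain t where t: "holomorphic_fun A (fst T \<inter> fst T') t"
      "\<forall>z\<in>fst T \<inter> fst T'. t z \<noteq> 0 \<and> (\<forall>u\<in>fibre L z. snd T' z u = t z * snd T z u)"
    using trivializations_holomorphic[OF assms] by blast
  have "smooth_fun A (fst T \<inter> fst T') t"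
    by (rule holomorphic_fun_smooth[OF open_A openin_Int t(1)]) (use assms trivialization_openin in auto)
  then show thesis using t(2) by (intro that) auto
qed

context
  fixes T z assumes T: "T \<in> trivializations L" and z: "z \<in> fst T"
begin

lemma frame_in: "frame T z \<in> fibre L z" and frame_1: "snd T z (frame T z) = 1"
  using trivialization_bij[OF T z] unfolding unit_frame_def bij_betw_def
  by (simp_all add: inv_into_into f_inv_into_f)

lemma z_carrier: "z \<in> carrier_of A" using trivialization_carrier[OF T] z by blast

lemma fibre_frame: "u \<in> fibre L z \<Longrightarrow> u = fibre_scale L z (snd T z u) (frame T z)"
  using trivialization_bij[OF T z] fibre_scale_in[OF z_carrier frame_in] frame_1
    trivialization_scale[OF T z frame_in]
  unfolding bij_betw_def by (metis inj_on_eq_iff mult.right_neutral)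

lemma hermitian_scale:
  assumes "u \<in> fibre L z" "v \<in> fibre L z"
  shows "h z (fibre_scale L z a u) v = a * h z u v"
    and "h z u (fibre_scale L z a v) = cnj a * h z u v"
proof -
  have sym: "h z v u = cnj (h z u v)" if "u \<in> fibre L z" "v \<in> fibre L z" for u v
    using hermitian[OF z_carrier that(1)] that(2) by blast
  have sc: "h z (fibre_scale L z a u) v = a * h z u v" if "u \<in> fibre L z" "v \<in> fibre L z" for u v
    using hermitian[OF z_carrier that(1)] that(2) by blast
  show "h z (fibre_scale L z a u) v = a * h z u v" by (rule sc[OF assms])
  have "h z u (fibre_scale L z a v) = cnj (h z (fibre_scale L z a v) u)"
    using sym[OF fibre_scale_in[OF z_carrier assms(2)] assms(1)] by simp
  also have "\<dots> = cnj a * h z u v" using sc[OF assms(2,1)] sym[OF assms] by simp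
  finally show "h z u (fibre_scale L z a v) = cnj a * h z u v" .
qed

lemma frame_norm_pos: "frame_norm T z > 0"
proof -
  have "frame T z \<noteq> fibre_scale L z 0 (frame T z)"
    using trivialization_scale[OF T z frame_in, of 0] frame_1 by auto
  then show ?thesis
    using hermitian[OF z_carrier frame_in] unfolding frame_norm_def by simp
qed

lemma frame_norm_sq: "h z (frame T z) (frame T z) = of_real ((frame_norm T z)\<^sup>2)"
proof -
  have "h z (frame T z) (frame T z) = cnj (h z (frame T z) (frame T z))"
    using hermitian[OF z_carrier frame_in] frame_in by blast
  then have "Im (h z (frame T z) (frame T z)) = 0" by (simp add: complex_eq_iff)
  moreover have "Re (h z (frame T z) (frame T z)) = (frame_norm T z)\<^sup>2"
    using frame_norm_pos unfolding frame_norm_def by simp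
  ultimately show ?thesis by (simp add: complex_eq_iff)
qed

lemma hermitian_norm: "u \<in> fibre L z \<Longrightarrow> sqrt (Re (h z u u)) = cmod (snd T z u) * frame_norm T z"
proof -
  assume u: "u \<in> fibre L z"
  let ?a = "snd T z u" and ?e = "frame T z"
  have s: "fibre_scale L z ?a ?e \<in> fibre L z" by (rule fibre_scale_in[OF z_carrier frame_in])
  have "h z u u = h z (fibre_scale L z ?a ?e) (fibre_scale L z ?a ?e)"
    using fibre_frame[OF u] by simp
  also have "\<dots> = ?a * cnj ?a * of_real ((frame_norm T z)\<^sup>2)"
    by (simp add: hermitian_scale(1)[OF frame_in s] hermitian_scale(2)[OF frame_in frame_in] frame_norm_sq)
  also have "\<dots> = of_real ((cmod ?a * frame_norm T z)\<^sup>2)"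
    by (simp only: complex_norm_square[symmetric] power_mult_distrib of_real_mult of_real_power)
  finally show ?thesis using frame_norm_pos by simp
qed

lemma dual_fibre_eval:
  "\<xi> \<in> dual_fibre L z \<Longrightarrow> u \<in> fibre L z \<Longrightarrow> \<xi> u = snd T z u * \<xi> (frame T z)"
  using fibre_frame[of u] frame_in unfolding dual_fibre_def by (metis (mono_tags, lifting) mem_Collect_eq)

text \<open>The fibre is a complex line, so the supremum in the dual norm runs over a single value.\<close>

lemma dual_norm_eq:
  assumes "\<xi> \<in> dual_fibre L z"
  shows "dual_norm L h z \<xi> = cmod (\<xi> (frame T z)) / frame_norm T z"
proof -
  let ?r = "frame_norm T z"
  let ?u = "fibre_scale L z (of_real (1 / ?r)) (frame T z)"
  have u: "?u \<in> fibre L z" by (rule fibre_scale_in[OF z_carrier frame_in])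
  have tu: "snd T z ?u = of_real (1 / ?r)" using trivialization_scale[OF T z frame_in] frame_1 by simp
  have "cmod (\<xi> u) = cmod (\<xi> (frame T z)) / ?r" if "u \<in> fibre L z" "sqrt (Re (h z u u)) = 1" for u
    using that(2) dual_fibre_eval[OF assms that(1)] frame_norm_pos
    unfolding hermitian_norm[OF that(1)] by (simp add: norm_mult field_simps)
  moreover have "sqrt (Re (h z ?u ?u)) = 1"
    unfolding hermitian_norm[OF u] tu using frame_norm_pos by (simp add: norm_divide)
  ultimately have "{cmod (\<xi> u) | u. u \<in> fibre L z \<and> sqrt (Re (h z u u)) = 1} = {cmod (\<xi> (frame T z)) / ?r}"
    using u by (intro equalityI subsetI CollectI singletonI insertCI)
      (auto simp del: real_sqrt_eq_1_iff intro!: exI[of _ ?u])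
  then show ?thesis unfolding dual_norm_def by simp
qed

lemma circle_point_frame: "snd (circle_point T z w) (frame T z) = of_real (frame_norm T z) * w"
  using frame_in frame_1 by (simp add: circle_point_def)

lemma circle_point_dual: "snd (circle_point T z w) \<in> dual_fibre L z"
  using fibre_add_in[OF z_carrier] fibre_scale_in[OF z_carrier] trivialization_add[OF T z]
    trivialization_scale[OF T z]
  unfolding dual_fibre_def circle_point_def by (simp add: algebra_simps)

lemma circle_point_in: "circle_point T z w \<in> circle_bundle A L h \<longleftrightarrow> cmod w = 1"
proof -
  have "dual_norm L h z (snd (circle_point T z w)) = cmod w"
    unfolding dual_norm_eq[OF circle_point_dual] circle_point_frame
    using frame_norm_pos by (simp add: norm_mult)
  then show ?thesis
    using circle_point_dual[of w] z_carrier by (auto simp: circle_bundle_def circle_point_def)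
qed

lemma circle_bundle_point:
  assumes "(z, \<xi>) \<in> circle_bundle A L h"
  shows "cmod (\<xi> (frame T z)) = frame_norm T z"
    and "(z, \<xi>) = circle_point T z (\<xi> (frame T z) / of_real (frame_norm T z))"
proof -
  have \<xi>: "\<xi> \<in> dual_fibre L z" and n: "dual_norm L h z \<xi> = 1" using assms by (auto simp: circle_bundle_def)
  show "cmod (\<xi> (frame T z)) = frame_norm T z"
    using n dual_norm_eq[OF \<xi>] frame_norm_pos by (simp add: field_simps)
  have "\<xi> u = 0" if "u \<notin> fibre L z" for u using \<xi> that by (auto simp: dual_fibre_def)
  then show "(z, \<xi>) = circle_point T z (\<xi> (frame T z) / of_real (frame_norm T z))"
    using dual_fibre_eval[OF \<xi>] frame_norm_pos by (auto simp: circle_point_def)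
qed

lemma circle_action_point: "circle_action t (circle_point T z w) = circle_point T z (cis t * w)"
  by (auto simp: circle_action_def circle_point_def)

end

lemma fst_circle_point: "fst (circle_point T z w) = z"
  by (simp add: circle_point_def)

abbreviation "P \<equiv> circle_bundle_atlas A L h"
abbreviation "cchart c T w \<equiv> circle_bundle_chart A L h c T w"

lemma cchart_in: "c \<in> A \<Longrightarrow> T \<in> trivializations L \<Longrightarrow> cmod w = 1 \<Longrightarrow> cchart c T w \<in> P"
  unfolding circle_bundle_atlas_def by blast

lemma P_cases:
  assumes "cc \<in> P"
  obtains c T w where "c \<in> A" "T \<in> trivializations L" "cmod w = 1" "cc = cchart c T w"
  using assms unfolding circle_bundle_atlas_def by blast

context
  fixes c T w assumes c: "c \<in> A" and T: "T \<in> trivializations L" and w: "cmod w = 1"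
begin

lemma cchart_coordinates:
  assumes z: "z \<in> fst c" "z \<in> fst T" and t: "t \<in> {- pi<..<pi}"
  shows "circle_point T z (w * cis t) \<in> fst (cchart c T w)"
    and "snd (cchart c T w) (circle_point T z (w * cis t)) = (snd c z, t)"
proof -
  let ?r = "frame_norm T z"
  have r: "?r > 0" by (rule frame_norm_pos[OF T z(2)])
  have w0: "w \<noteq> 0" using w by auto
  have q: "snd (circle_point T z (w * cis t)) (frame T z) / w = of_real ?r * cis t"
    using w0 by (simp add: circle_point_frame[OF T z(2)])
  have a: "Arg (of_real ?r * cis t) = t" using Arg_polar[OF r] t by auto
  then have "of_real ?r * cis t \<notin> \<real>\<^sub>\<le>\<^sub>0" using t r Arg_less_pi_iff[of "of_real ?r * cis t"] by auto
  moreover have "circle_point T z (w * cis t) \<in> circle_bundle A L h"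
    using circle_point_in[OF T z(2)] w by (simp add: norm_mult)
  ultimately show "circle_point T z (w * cis t) \<in> fst (cchart c T w)"
    using q z by (simp add: circle_bundle_chart_def circle_point_def)
  show "snd (cchart c T w) (circle_point T z (w * cis t)) = (snd c z, t)"
    using q a by (simp add: circle_bundle_chart_def circle_point_def)
qed

lemma cchart_point:
  assumes p: "p \<in> fst (cchart c T w)"
  obtains z t where "z \<in> fst c" "z \<in> fst T" "t \<in> {- pi<..<pi}" "p = circle_point T z (w * cis t)"
proof -
  obtain z \<xi> where zx: "p = (z, \<xi>)" by (cases p)
  then have b: "(z, \<xi>) \<in> circle_bundle A L h" and z: "z \<in> fst c" "z \<in> fst T"
    and n: "\<xi> (frame T z) / w \<notin> \<real>\<^sub>\<le>\<^sub>0"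
    using p by (auto simp: circle_bundle_chart_def)
  let ?q = "\<xi> (frame T z) / w"
  have w0: "w \<noteq> 0" using w by auto
  have r: "frame_norm T z > 0" by (rule frame_norm_pos[OF T z(2)])
  have q: "cmod ?q = frame_norm T z" using circle_bundle_point(1)[OF T z(2) b] w by (simp add: norm_divide)
  have "?q = of_real (frame_norm T z) * cis (Arg ?q)" using polar_Arg[of ?q] q by simp
  then have "\<xi> (frame T z) = of_real (frame_norm T z) * cis (Arg ?q) * w" using w0 by (simp add: field_simps)
  then have "\<xi> (frame T z) / of_real (frame_norm T z) = w * cis (Arg ?q)"
    using r by (simp add: nonzero_divide_eq_eq mult.commute mult.left_commute)
  moreover have "Arg ?q \<in> {- pi<..<pi}" using n mpi_less_Arg Arg_less_pi_iff by simp
  ultimately show thesis using that[OF z] circle_bundle_point(2)[OF T z(2) b] zx by metis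
qed

lemma cchart_inj: "inj_on (snd (cchart c T w)) (fst (cchart c T w))"
proof (rule inj_onI)
  fix p q assume p: "p \<in> fst (cchart c T w)" and q: "q \<in> fst (cchart c T w)"
    and e: "snd (cchart c T w) p = snd (cchart c T w) q"
  obtain z t where z: "z \<in> fst c" "z \<in> fst T" "t \<in> {- pi<..<pi}" "p = circle_point T z (w * cis t)"
    by (rule cchart_point[OF p])
  obtain z' t' where z': "z' \<in> fst c" "z' \<in> fst T" "t' \<in> {- pi<..<pi}" "q = circle_point T z' (w * cis t')"
    by (rule cchart_point[OF q])
  have "(snd c z, t) = (snd c z', t')"
    using e cchart_coordinates(2)[OF z(1-3)] cchart_coordinates(2)[OF z'(1-3)] z(4) z'(4) by simp
  then show "p = q" using z(1,4) z'(1,4) open_charts_inj[OF open_A c] by (auto dest: inj_onD)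
qed

lemma cchart_image: "snd (cchart c T w) ` fst (cchart c T w) = chart_image c (fst T) \<times> {- pi<..<pi}"
proof
  show "snd (cchart c T w) ` fst (cchart c T w) \<subseteq> chart_image c (fst T) \<times> {- pi<..<pi}"
    using cchart_coordinates(2) by (auto simp: chart_image_def elim!: cchart_point)
  show "chart_image c (fst T) \<times> {- pi<..<pi} \<subseteq> snd (cchart c T w) ` fst (cchart c T w)"
  proof clarify
    fix y t assume "y \<in> chart_image c (fst T)" and t: "t \<in> {- pi<..<pi}"
    then obtain z where z: "z \<in> fst c" "z \<in> fst T" "y = snd c z" by (auto simp: chart_image_def)
    show "(y, t) \<in> snd (cchart c T w) ` fst (cchart c T w)"
      using cchart_coordinates[OF z(1,2) t] z(3) by (metis imageI)
  qed
qed

lemma cchart_inv: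
  assumes "y \<in> chart_image c (fst T)" "t \<in> {- pi<..<pi}"
  shows "chart_inv (cchart c T w) (y, t) = circle_point T (chart_inv c y) (w * cis t)"
proof -
  obtain z where z: "z \<in> fst c" "z \<in> fst T" "y = snd c z" using assms(1) by (auto simp: chart_image_def)
  have "chart_inv c y = z" using z chart_inv_left[OF open_charts_inj[OF open_A c]] by simp
  then show ?thesis
    using chart_inv_left[OF cchart_inj cchart_coordinates(1)[OF z(1,2) assms(2)]]
      cchart_coordinates(2)[OF z(1,2) assms(2)] z(3) by simp
qed

lemma cchart_open: "open (snd (cchart c T w) ` fst (cchart c T w))"
  unfolding cchart_image
  by (intro open_Times openin_chart_image[OF open_A trivialization_openin[OF T] c] open_greaterThanLessThan)

text \<open>A set that is saturated for the projection imposes no condition on the angle.\<close>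

lemma cchart_image_preimage:
  "chart_image (cchart c T w) {p \<in> circle_bundle A L h. bundle_proj p \<in> W} =
    chart_image c (fst T \<inter> W) \<times> {- pi<..<pi}"
proof -
  have in_cb: "circle_point T (chart_inv c y) (w * cis t) \<in> circle_bundle A L h"
    if "y \<in> chart_image c (fst T)" for y t
    using circle_point_in[OF T chart_image_inv[OF open_charts_inj[OF open_A c] that]] w by (simp add: norm_mult)
  have "chart_image (cchart c T w) {p \<in> circle_bundle A L h. bundle_proj p \<in> W} =
    {q \<in> chart_image c (fst T) \<times> {- pi<..<pi}. chart_inv c (fst q) \<in> W}"
    unfolding chart_image_eq[OF cchart_inj] cchart_image
    by (auto simp: cchart_inv bundle_proj_def fst_circle_point in_cb simp del: greaterThanLessThan_iff)
  also have "\<dots> = chart_image c (fst T \<inter> W) \<times> {- pi<..<pi}"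
    by (auto simp: chart_image_eq[OF open_charts_inj[OF open_A c]])
  finally show ?thesis .
qed

end

lemma open_P: "open_charts P"
  unfolding open_charts_def using cchart_inj cchart_open by (auto elim!: P_cases)

text \<open>The cut of the angle can be chosen such that a given point has the angle \<open>0\<close>.\<close>

lemma circle_point_angle_0:
  assumes "p \<in> circle_bundle A L h" "T \<in> trivializations L" "fst p \<in> fst T"
  obtains w where "cmod w = 1" "p = circle_point T (fst p) (w * cis 0)"
proof -
  let ?w = "snd p (frame T (fst p)) / of_real (frame_norm T (fst p))"
  have p: "(fst p, snd p) \<in> circle_bundle A L h" using assms(1) by simp
  show thesis
    using that[of ?w] circle_bundle_point[OF assms(2,3) p] frame_norm_pos[OF assms(2,3)]
    by (simp add: norm_divide)
qed

lemma circle_bundle_carrier: "p \<in> circle_bundle A L h \<Longrightarrow> fst p \<in> carrier_of A"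
  by (auto simp: circle_bundle_def)

lemma ex_cchart:
  assumes "p \<in> circle_bundle A L h"
  obtains c T w where "c \<in> A" "T \<in> trivializations L" "cmod w = 1" "fst p \<in> fst c" "fst p \<in> fst T"
    "p = circle_point T (fst p) (w * cis 0)" "p \<in> fst (cchart c T w)"
proof -
  obtain c where c: "c \<in> A" "fst p \<in> fst c" using circle_bundle_carrier[OF assms] by (auto simp: carrier_of_def)
  obtain T where T: "T \<in> trivializations L" "fst p \<in> fst T"
    using ex_trivialization[OF circle_bundle_carrier[OF assms]] by blast
  obtain w where w: "cmod w = 1" "p = circle_point T (fst p) (w * cis 0)"
    by (rule circle_point_angle_0[OF assms T])
  have "p \<in> fst (cchart c T w)"
    using cchart_coordinates(1)[OF c(1) T(1) w(1) c(2) T(2), of 0] w(2) pi_gt_zero by simp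
  then show thesis using that c T w by blast
qed

lemma carrier_P: "carrier_of P = circle_bundle A L h"
proof
  show "carrier_of P \<subseteq> circle_bundle A L h"
    by (auto simp: carrier_of_def circle_bundle_chart_def elim!: P_cases)
  show "circle_bundle A L h \<subseteq> carrier_of P"
    unfolding carrier_of_def using cchart_in by (fast elim!: ex_cchart)
qed

lemma topspace_A: "topspace (atlas_topology A) = carrier_of A"
  by (rule topspace_atlas_topology[OF open_A])

lemma topspace_P: "topspace (atlas_topology P) = circle_bundle A L h"
  by (simp add: topspace_atlas_topology[OF open_P] carrier_P)

section \<open>The topology of the projection\<close>

lemma openin_preimage:
  assumes "openin (atlas_topology A) W"
  shows "openin (atlas_topology P) {p \<in> circle_bundle A L h. bundle_proj p \<in> W}"
proof -
  have "open (chart_image cc {p \<in> circle_bundle A L h. bundle_proj p \<in> W})" if cc: "cc \<in> P" for cc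
    using cc
  proof (rule P_cases)
    fix c T w assume c: "c \<in> A" "T \<in> trivializations L" "cmod w = 1" and cc: "cc = cchart c T w"
    show ?thesis
      unfolding cc cchart_image_preimage[OF c]
      by (intro open_Times openin_chart_image[OF open_A _ c(1)] openin_Int assms trivialization_openin[OF c(2)]
          open_greaterThanLessThan)
  qed
  then show ?thesis unfolding openin_open_charts[OF open_P] carrier_P by blast
qed

lemma continuous_bundle_proj: "continuous_map (atlas_topology P) (atlas_topology A) bundle_proj"
  unfolding continuous_map_def topspace_A topspace_P
  using openin_preimage circle_bundle_carrier by (auto simp: bundle_proj_def)

lemma bundle_proj_surj: "bundle_proj ` circle_bundle A L h = carrier_of A"
proof
  show "bundle_proj ` circle_bundle A L h \<subseteq> carrier_of A"
    using circle_bundle_carrier by (auto simp: bundle_proj_def)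
  show "carrier_of A \<subseteq> bundle_proj ` circle_bundle A L h"
  proof
    fix z assume "z \<in> carrier_of A"
    then obtain T where T: "T \<in> trivializations L" "z \<in> fst T" using ex_trivialization by blast
    have "circle_point T z 1 \<in> circle_bundle A L h" using circle_point_in[OF T] by simp
    then show "z \<in> bundle_proj ` circle_bundle A L h"
      using fst_circle_point[of T z 1] unfolding bundle_proj_def by (metis imageI)
  qed
qed

text \<open>In coordinates the projection is the projection of a product to its first factor.\<close>

lemma open_bundle_proj: "open_map (atlas_topology P) (atlas_topology A) bundle_proj"
  unfolding open_map_def
proof (intro allI impI)
  fix W assume W: "openin (atlas_topology P) W"
  have Wc: "W \<subseteq> circle_bundle A L h" using openin_subset[OF W] topspace_P by simp
  show "openin (atlas_topology A) (bundle_proj ` W)"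
    unfolding openin_open_charts[OF open_A]
  proof (intro conjI ballI)
    show "bundle_proj ` W \<subseteq> carrier_of A" using Wc bundle_proj_surj by blast
    fix c assume c: "c \<in> A"
    show "open (chart_image c (bundle_proj ` W))"
    proof (subst open_subopen, rule ballI)
      fix y assume "y \<in> chart_image c (bundle_proj ` W)"
      then obtain p where p: "p \<in> W" "fst p \<in> fst c" "y = snd c (fst p)"
        by (auto simp: chart_image_def bundle_proj_def)
      have pc: "p \<in> circle_bundle A L h" using p(1) Wc by blast
      obtain T where T: "T \<in> trivializations L" "fst p \<in> fst T"
        using ex_trivialization[OF circle_bundle_carrier[OF pc]] by blast
      obtain w where w: "cmod w = 1" "p = circle_point T (fst p) (w * cis 0)"
        by (rule circle_point_angle_0[OF pc T])
      have 0: "(0::real) \<in> {- pi<..<pi}" by simp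
      let ?C = "cchart c T w"
      let ?V = "fst ` chart_image ?C W"
      have pC: "p \<in> fst ?C" "snd ?C p = (y, 0)"
        using cchart_coordinates[OF c T(1) w(1) p(2) T(2) 0] w(2) p(3) by simp_all
      have "open ?V"
        by (rule open_image_fst[OF openin_chart_image[OF open_P W cchart_in[OF c T(1) w(1)]]])
      moreover have "y \<in> ?V"
        using pC p(1) unfolding chart_image_def by (intro image_eqI[of _ fst "(y,0)"]) (auto intro!: image_eqI[of _ _ p])
      moreover have "?V \<subseteq> chart_image c (bundle_proj ` W)"
      proof
        fix y' assume "y' \<in> ?V"
        then obtain q where q: "q \<in> fst ?C" "q \<in> W" "y' = fst (snd ?C q)" unfolding chart_image_def by auto
        obtain z t where z: "z \<in> fst c" "z \<in> fst T" "t \<in> {- pi<..<pi}" "q = circle_point T z (w * cis t)"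
          by (rule cchart_point[OF c T(1) w(1) q(1)])
        have "y' = snd c z" using q(3) cchart_coordinates(2)[OF c T(1) w(1) z(1-3)] z(4) by simp
        moreover have "z \<in> bundle_proj ` W"
          using q(2) z(4) fst_circle_point[of T z] unfolding bundle_proj_def by (metis imageI)
        ultimately show "y' \<in> chart_image c (bundle_proj ` W)" using z(1) by (auto simp: chart_image_def)
      qed
      ultimately show "\<exists>V. open V \<and> y \<in> V \<and> V \<subseteq> chart_image c (bundle_proj ` W)" by blast
    qed
  qed
qed

lemma circle_action_in: "p \<in> circle_bundle A L h \<Longrightarrow> circle_action t p \<in> circle_bundle A L h"
proof -
  assume p: "p \<in> circle_bundle A L h"
  obtain c T w where "T \<in> trivializations L" "fst p \<in> fst T" "cmod w = 1" "p = circle_point T (fst p) (w * cis 0)"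
    using p by (rule ex_cchart)
  then show ?thesis by (metis circle_action_point circle_point_in norm_mult norm_cis mult.right_neutral)
qed

lemma circle_action_add: "circle_action s (circle_action t p) = circle_action (s + t) p"
  by (simp add: circle_action_def cis_mult mult.assoc[symmetric])

lemma circle_action_fibre:
  assumes "p \<in> circle_bundle A L h" "q \<in> circle_bundle A L h" "fst p = fst q"
  shows "\<exists>t. q = circle_action t p"
proof -
  obtain c T w where T: "T \<in> trivializations L" "fst p \<in> fst T" and w: "cmod w = 1" "p = circle_point T (fst p) (w * cis 0)"
    using assms(1) by (rule ex_cchart)
  let ?w = "snd q (frame T (fst p)) / of_real (frame_norm T (fst p))"
  have q: "(fst p, snd q) \<in> circle_bundle A L h" using assms(2,3) by simp
  have w': "cmod ?w = 1" "q = circle_point T (fst p) ?w"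
    using circle_bundle_point[OF T q] frame_norm_pos[OF T] assms(3) by (simp_all add: norm_divide)
  have "cmod (?w / w) = 1" using w(1) w'(1) by (simp only: norm_divide div_by_1)
  then have "cis (Arg (?w / w)) = ?w / w" using polar_Arg[of "?w / w"] by simp
  moreover have "w \<noteq> 0" using w(1) by auto
  ultimately have "cis (Arg (?w / w)) * (w * cis 0) = ?w" by simp
  then have "q = circle_action (Arg (?w / w)) (circle_point T (fst p) (w * cis 0))"
    unfolding circle_action_point[OF T] using w'(2) by simp
  then show ?thesis using w(2)[symmetric] by auto
qed

text \<open>The action multiplies phases, so in coordinates it translates the angle; beyond \<open>\<plusminus>\<pi>\<close> the orbit
  leaves the chart.\<close>

lemma circle_action_coordinates:
  assumes "c \<in> A" "T \<in> trivializations L" "cmod w = 1" "y \<in> chart_image c (fst T)"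
    and "t \<in> {- pi<..<pi}" "t + s \<in> {- pi<..<pi}"
  shows "circle_action s (chart_inv (cchart c T w) (y, t)) = chart_inv (cchart c T w) (y, t + s)"
proof -
  have z: "chart_inv c y \<in> fst T" by (rule chart_image_inv[OF open_charts_inj[OF open_A assms(1)] assms(4)])
  show ?thesis
    unfolding cchart_inv[OF assms(1-5)] cchart_inv[OF assms(1-4) assms(6)] circle_action_point[OF assms(2) z]
    by (simp add: cis_mult[symmetric] algebra_simps)
qed

lemma continuous_orbit:
  assumes "p \<in> circle_bundle A L h"
  shows "continuous_map euclidean (atlas_topology P) (\<lambda>t. circle_action t p)"
  unfolding continuous_map_def topspace_P topspace_euclidean
proof (intro conjI allI impI)
  show "(\<lambda>t. circle_action t p) \<in> UNIV \<rightarrow> circle_bundle A L h" using circle_action_in[OF assms] by auto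
  fix W assume W: "openin (atlas_topology P) W"
  have "\<exists>S. open S \<and> t0 \<in> S \<and> S \<subseteq> {t. circle_action t p \<in> W}" if t0: "circle_action t0 p \<in> W" for t0
  proof -
    let ?q = "circle_action t0 p"
    obtain c T w where c: "c \<in> A" and T: "T \<in> trivializations L" and w: "cmod w = 1"
      and z: "fst ?q \<in> fst c" "fst ?q \<in> fst T" and q: "?q = circle_point T (fst ?q) (w * cis 0)"
      using circle_action_in[OF assms, of t0] by (rule ex_cchart)
    let ?C = "cchart c T w" and ?y = "snd c (fst ?q)"
    let ?S = "{t. (?y, t - t0) \<in> chart_image ?C W}"
    have 0: "(0::real) \<in> {- pi<..<pi}" by simp
    have y: "?y \<in> chart_image c (fst T)" using z by (auto simp: chart_image_def)
    have inv: "chart_inv ?C (?y, 0) = ?q"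
      unfolding cchart_inv[OF c T w y 0] chart_inv_left[OF open_charts_inj[OF open_A c] z(1)] using q by simp
    have "open ((\<lambda>t. (?y, t - t0)) -` chart_image ?C W)"
      by (rule open_vimage[OF openin_chart_image[OF open_P W cchart_in[OF c T w]]]) (auto intro!: continuous_intros)
    then have "open ?S" by (simp add: vimage_def)
    moreover have "t0 \<in> ?S"
      using t0 inv y 0 by (simp add: chart_image_eq[OF cchart_inj[OF c T w]] cchart_image[OF c T w])
    moreover have "?S \<subseteq> {t. circle_action t p \<in> W}"
    proof clarify
      fix t assume "(?y, t - t0) \<in> chart_image ?C W"
      then have t: "0 + (t - t0) \<in> {- pi<..<pi}" and iW: "chart_inv ?C (?y, t - t0) \<in> W"
        by (auto simp: chart_image_eq[OF cchart_inj[OF c T w]] cchart_image[OF c T w])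
      have "circle_action (t - t0) ?q = chart_inv ?C (?y, t - t0)"
        using circle_action_coordinates[OF c T w y 0 t] inv by simp
      then show "circle_action t p \<in> W" using iW by (simp add: circle_action_add)
    qed
    ultimately show ?thesis by blast
  qed
  then have "open {t. circle_action t p \<in> W}" by (subst open_subopen) blast
  then show "openin euclidean {x \<in> UNIV. circle_action x p \<in> W}" by simp
qed

text \<open>A fibre is an orbit, hence a continuous image of the real line.\<close>

lemma monotone_bundle_proj: "monotone_map (atlas_topology P) (atlas_topology A) bundle_proj"
  unfolding monotone_map_def topspace_A topspace_P
proof (intro conjI ballI)
  show "bundle_proj ` circle_bundle A L h \<subseteq> carrier_of A" using bundle_proj_surj by simp
  fix z assume "z \<in> carrier_of A"
  then have "z \<in> bundle_proj ` circle_bundle A L h" by (simp only: bundle_proj_surj)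
  then obtain p where p: "p \<in> circle_bundle A L h" "fst p = z" unfolding bundle_proj_def by (metis imageE)
  have "{x \<in> circle_bundle A L h. bundle_proj x = z} = range (\<lambda>t. circle_action t p)"
  proof (intro equalityI subsetI)
    fix x assume "x \<in> {x \<in> circle_bundle A L h. bundle_proj x = z}"
    then show "x \<in> range (\<lambda>t. circle_action t p)"
      using circle_action_fibre[OF p(1), of x] p(2) by (auto simp: bundle_proj_def)
  next
    fix x assume "x \<in> range (\<lambda>t. circle_action t p)"
    then show "x \<in> {x \<in> circle_bundle A L h. bundle_proj x = z}"
      using circle_action_in[OF p(1)] p(2) by (auto simp: bundle_proj_def circle_action_def)
  qed
  moreover have "connectedin (atlas_topology P) (range (\<lambda>t. circle_action t p))"
    by (rule connectedin_continuous_map_image[OF continuous_orbit[OF p(1)]]) (simp add: connectedin_iff_connected)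
  ultimately show "connectedin (atlas_topology P) {x \<in> circle_bundle A L h. bundle_proj x = z}" by simp
qed

lemma nodal_set_pullback:
  "nodal_set P (\<psi> \<circ> bundle_proj) = {p \<in> circle_bundle A L h. bundle_proj p \<in> nodal_set A \<psi>}"
  using circle_bundle_carrier by (auto simp: nodal_set_def carrier_P bundle_proj_def)

lemma nodal_domains_pullback: "nodal_domains P (\<psi> \<circ> bundle_proj) \<approx> nodal_domains A \<psi>"
proof -
  let ?V = "carrier_of A - nodal_set A \<psi>" and ?U = "carrier_of P - nodal_set P (\<psi> \<circ> bundle_proj)"
  have U: "{p \<in> topspace (atlas_topology P). bundle_proj p \<in> ?V} = ?U"
    unfolding topspace_P carrier_P nodal_set_pullback using bundle_proj_surj by auto
  have "?V \<subseteq> bundle_proj ` circle_bundle A L h" unfolding bundle_proj_surj by blast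
  then have im: "bundle_proj ` ?U = ?V" unfolding U[symmetric] topspace_P by blast
  show ?thesis
    unfolding nodal_domains_def
  proof (rule connected_components_of_eqpoll[where f = bundle_proj])
    show "continuous_map (subtopology (atlas_topology P) ?U) (subtopology (atlas_topology A) ?V) bundle_proj"
      using im by (auto simp: continuous_map_in_subtopology topspace_subtopology
          intro: continuous_map_from_subtopology[OF continuous_bundle_proj])
    show "open_map (subtopology (atlas_topology P) ?U) (subtopology (atlas_topology A) ?V) bundle_proj"
      by (rule open_map_restriction[OF open_bundle_proj U])
    show "bundle_proj ` topspace (subtopology (atlas_topology P) ?U) =
        topspace (subtopology (atlas_topology A) ?V)"
      using im by (simp add: topspace_subtopology topspace_A topspace_P carrier_P Int_absorb1 Diff_subset)
    show "monotone_map (subtopology (atlas_topology P) ?U) (subtopology (atlas_topology A) ?V) bundle_proj"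
      by (rule monotone_map_restriction) (use monotone_bundle_proj U in blast)
  qed
qed

end

section \<open>Smooth functions and sections\<close>

lemma smooth_on_fst_compose:
  fixes f :: "'a::euclidean_space \<Rightarrow> 'c::real_normed_vector" and I :: "'b::euclidean_space set"
  assumes "open S" "open I" "smooth_on S f"
  shows "smooth_on (S \<times> I) (\<lambda>q. f (fst q))"
  by (rule smooth_on_compose[OF open_Times[OF assms(1,2)] assms(1) _
        smooth_on_bounded_linear[OF bounded_linear_fst] assms(3)]) auto

lemma frechet_derivative_fst:
  fixes f :: "'a::euclidean_space \<Rightarrow> 'c::real_normed_vector"
  assumes "f differentiable at (fst q)"
  shows "frechet_derivative (\<lambda>q. f (fst q)) (at q) v = frechet_derivative f (at (fst q)) (fst v)"
  by (rule frechet_derivative_eq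
      [OF has_derivative_compose[OF has_derivative_fst[OF has_derivative_ident] frechet_derivative_has[OF assms]]])

context hermitian_line_bundle
begin

text \<open>In coordinates a pullback is a function of the first variable only, and the function on the base
  is recovered by restriction to the slice at angle \<open>0\<close>.\<close>

lemma smooth_fun_pullback:
  fixes f :: "'x \<Rightarrow> 'b::real_normed_vector"
  assumes W: "openin (atlas_topology A) W"
  shows "smooth_fun P {p \<in> circle_bundle A L h. bundle_proj p \<in> W} (f \<circ> bundle_proj) \<longleftrightarrow> smooth_fun A W f"
    (is "?l \<longleftrightarrow> ?r")
proof -
  let ?I = "{- pi<..<pi}"
  have eq: "(f \<circ> bundle_proj \<circ> chart_inv (cchart c T w)) q = (f \<circ> chart_inv c) (fst q)"
    if "c \<in> A" "T \<in> trivializations L" "cmod w = 1" "q \<in> chart_image c (fst T \<inter> W) \<times> ?I" for c T w q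
  proof -
    have "fst q \<in> chart_image c (fst T)" "snd q \<in> ?I" using that(4) by (auto simp: chart_image_def)
    then have "chart_inv (cchart c T w) (fst q, snd q) = circle_point T (chart_inv c (fst q)) (w * cis (snd q))"
      by (rule cchart_inv[OF that(1-3)])
    then show ?thesis by (simp add: bundle_proj_def fst_circle_point)
  qed
  have op: "open (chart_image c (fst T \<inter> W))" if "c \<in> A" "T \<in> trivializations L" for c T
    by (rule openin_chart_image[OF open_A openin_Int[OF trivialization_openin[OF that(2)] W] that(1)])
  show ?thesis
  proof
    assume r: ?r
    show ?l
      unfolding smooth_fun_def
    proof
      fix cc assume "cc \<in> P"
      then show "smooth_on (chart_image cc {p \<in> circle_bundle A L h. bundle_proj p \<in> W}) (f \<circ> bundle_proj \<circ> chart_inv cc)"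
      proof (rule P_cases)
        fix c T w assume c: "c \<in> A" "T \<in> trivializations L" "cmod w = 1" and cc: "cc = cchart c T w"
        have "smooth_on (chart_image c (fst T \<inter> W)) (f \<circ> chart_inv c)"
          using smooth_fun_subset[OF r, of "fst T \<inter> W"] c(1) by (simp add: smooth_fun_def)
        then have "smooth_on (chart_image c (fst T \<inter> W) \<times> ?I) (\<lambda>q. (f \<circ> chart_inv c) (fst q))"
          by (intro smooth_on_fst_compose op c open_greaterThanLessThan)
        then show ?thesis
          unfolding cc cchart_image_preimage[OF c]
          by (rule smooth_on_cong[OF open_Times[OF op[OF c(1,2)] open_greaterThanLessThan] eq[OF c, symmetric], rotated])
      qed
    qed
  next
    assume l: ?l
    show ?r
      unfolding smooth_fun_def
    proof (intro ballI smooth_on_local)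
      fix c y assume c: "c \<in> A" and y: "y \<in> chart_image c W"
      have "chart_inv c y \<in> carrier_of A"
        using chart_image_inv[OF open_charts_inj[OF open_A c] y] openin_subset[OF W] topspace_A by blast
      then obtain T where T: "T \<in> trivializations L" "chart_inv c y \<in> fst T" using ex_trivialization by blast
      note cT = c T(1) norm_one[where 'a = complex]
      let ?S = "chart_image c (fst T \<inter> W)"
      have sm: "smooth_on (?S \<times> ?I) (f \<circ> bundle_proj \<circ> chart_inv (cchart c T 1))"
        using l cchart_in[OF cT] unfolding smooth_fun_def cchart_image_preimage[OF cT, symmetric] by blast
      have "smooth_on ?S (\<lambda>y. (f \<circ> bundle_proj \<circ> chart_inv (cchart c T 1)) (y, 0))"
      proof (rule smooth_on_compose[OF op[OF c T(1)] open_Times[OF op[OF c T(1)] open_greaterThanLessThan] _ _ sm])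
        show "smooth_on ?S (\<lambda>y. (y, 0::real))"
          by (intro smooth_on_bounded_linear bounded_linear_Pair bounded_linear_ident bounded_linear_zero)
      qed auto
      then have "smooth_on ?S (f \<circ> chart_inv c)"
        by (rule smooth_on_cong[OF op[OF c T(1)], rotated]) (use eq[OF cT] in auto)
      moreover have "y \<in> ?S"
        using y T(2) by (simp add: chart_image_eq[OF open_charts_inj[OF open_A c]])
      ultimately show "\<exists>S. open S \<and> y \<in> S \<and> smooth_on S (f \<circ> chart_inv c)" using op[OF c T(1)] by blast
    qed
  qed
qed

lemma smooth_fun_mult:
  fixes f f' :: "'x \<Rightarrow> complex"
  shows "openin (atlas_topology A) W \<Longrightarrow> smooth_fun A W f \<Longrightarrow> smooth_fun A W f' \<Longrightarrow> smooth_fun A W (\<lambda>z. f z * f' z)"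
  by (rule smooth_fun_bilinear[OF bounded_bilinear_mult open_A])

lemma smooth_section_frame:
  assumes "T \<in> trivializations L" shows "smooth_section A L (fst T) (frame T)"
  unfolding smooth_section_def case_prod_unfold
proof (intro conjI ballI)
  show "frame T z \<in> fibre L z" if "z \<in> fst T" for z by (rule frame_in[OF assms that])
  fix T' assume T': "T' \<in> trivializations L"
  obtain t where t: "smooth_fun A (fst T \<inter> fst T') t"
    "\<And>z u. z \<in> fst T \<inter> fst T' \<Longrightarrow> u \<in> fibre L z \<Longrightarrow> snd T' z u = t z * snd T z u"
    using trivialization_transition[OF assms T'] by blast
  show "smooth_fun A (fst T \<inter> fst T') (\<lambda>z. snd T' z (frame T z))"
    by (rule smooth_fun_cong[OF open_A _ _ t(1)])
      (use t(2) frame_in[OF assms] frame_1[OF assms] trivialization_openin[OF assms] trivialization_openin[OF T']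
        in \<open>auto intro!: openin_Int\<close>)
qed

lemma smooth_section_near_frame:
  "T \<in> trivializations L \<Longrightarrow> z \<in> fst T \<Longrightarrow> smooth_section_near A L z (frame T)"
  unfolding smooth_section_near_def using smooth_section_frame trivialization_openin by blast

lemma smooth_frame_norm:
  assumes T: "T \<in> trivializations L" shows "smooth_fun A (fst T) (frame_norm T)"
proof -
  have s: "smooth_fun A (fst T) (\<lambda>z. h z (frame T z) (frame T z))"
    using h smooth_section_frame[OF T] trivialization_openin[OF T] unfolding hermitian_metric_def by blast
  have "smooth_fun A (fst T) (\<lambda>z. Re (h z (frame T z) (frame T z)))"
    by (rule smooth_fun_linear[OF open_A trivialization_openin[OF T] s bounded_linear_Re])
  then have "smooth_fun A (fst T) (\<lambda>z. sqrt (Re (h z (frame T z) (frame T z))))"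
    by (rule smooth_fun_compose[OF open_A trivialization_openin[OF T] _ open_greaterThan _ smooth_on_sqrt])
      (use frame_norm_pos[OF T] in \<open>auto simp: frame_norm_def\<close>)
  then show ?thesis unfolding frame_norm_def[abs_def] .
qed

text \<open>A section of the circle bundle is given by a phase function \<open>\<alpha>\<close>; composing with it amounts to
  substituting \<open>\<alpha>\<close> for the angular coordinate.\<close>

definition phase_point where "phase_point T w \<alpha> u = circle_point T u (w * cis (\<alpha> u))"

context
  fixes T w W \<alpha> z
  assumes T: "T \<in> trivializations L" and w: "cmod w = 1"
    and W: "openin (atlas_topology A) W" "W \<subseteq> fst T" "z \<in> W"
    and \<alpha>: "smooth_fun A W \<alpha>" "\<alpha> z \<in> {- pi<..<pi}"
begin

lemma smooth_near_phase_point: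
  fixes f :: "'x \<times> ('l \<Rightarrow> complex) \<Rightarrow> 'b::real_normed_vector"
  assumes f: "smooth_near P (phase_point T w \<alpha> z) f"
  shows "smooth_near A z (f \<circ> phase_point T w \<alpha>)"
proof -
  obtain Q where Q: "openin (atlas_topology P) Q" "phase_point T w \<alpha> z \<in> Q" "smooth_fun P Q f"
    using f unfolding smooth_near_def by blast
  let ?V = "{u \<in> W. \<alpha> u \<in> {- pi<..<pi} \<and> phase_point T w \<alpha> u \<in> Q}"
  have sub: "W \<subseteq> carrier_of A" using openin_subset[OF W(1)] topspace_A by simp
  have key: "open (chart_image c ?V) \<and> smooth_on (chart_image c ?V) (f \<circ> phase_point T w \<alpha> \<circ> chart_inv c)" if c: "c \<in> A" for c
  proof -
    let ?C = "cchart c T w"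
    let ?s = "\<lambda>y. (y, \<alpha> (chart_inv c y))"
    let ?CQ = "chart_image ?C Q"
    have inj: "inj_on (snd c) (fst c)" by (rule open_charts_inj[OF open_A c])
    have oW: "open (chart_image c W)" by (rule openin_chart_image[OF open_A W(1) c])
    have oQ: "open ?CQ" by (rule openin_chart_image[OF open_P Q(1) cchart_in[OF c T w]])
    have "smooth_on (chart_image c W) (\<alpha> \<circ> chart_inv c)" using \<alpha>(1) c by (simp add: smooth_fun_def)
    then have s: "smooth_on (chart_image c W) ?s"
      by (intro smooth_on_Pair oW smooth_on_bounded_linear[OF bounded_linear_ident]) (simp add: comp_def)
    have inv: "chart_inv ?C (?s y) = phase_point T w \<alpha> (chart_inv c y)"
      if "y \<in> chart_image c W" "\<alpha> (chart_inv c y) \<in> {- pi<..<pi}" for y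
      unfolding phase_point_def
      by (rule cchart_inv[OF c T w _ that(2)]) (use that(1) W(2) in \<open>auto simp: chart_image_def\<close>)
    have im: "chart_image c ?V = chart_image c W \<inter> ?s -` ?CQ"
    proof (intro equalityI subsetI)
      fix y assume "y \<in> chart_image c ?V"
      then have y: "y \<in> chart_image c W" "\<alpha> (chart_inv c y) \<in> {- pi<..<pi}" "phase_point T w \<alpha> (chart_inv c y) \<in> Q"
        "y \<in> chart_image c (fst T)"
        using W(2) by (auto simp: chart_image_eq[OF inj])
      then show "y \<in> chart_image c W \<inter> ?s -` ?CQ"
        using inv[OF y(1,2)] by (simp add: chart_image_eq[OF cchart_inj[OF c T w]] cchart_image[OF c T w])
    next
      fix y assume "y \<in> chart_image c W \<inter> ?s -` ?CQ"
      then have y: "y \<in> chart_image c W" "\<alpha> (chart_inv c y) \<in> {- pi<..<pi}" "chart_inv ?C (?s y) \<in> Q"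
        by (auto simp: chart_image_eq[OF cchart_inj[OF c T w]] cchart_image[OF c T w])
      then show "y \<in> chart_image c ?V" using inv[OF y(1,2)] by (simp add: chart_image_eq[OF inj])
    qed
    have "continuous_on (chart_image c W) ?s"
      using s unfolding smooth_on_def by (metis times_differentiable_on.simps(1))
    then have o: "open (chart_image c ?V)"
      unfolding im by (rule continuous_open_preimage[OF _ oW oQ])
    have "smooth_on (chart_image c ?V) (\<lambda>y. (f \<circ> chart_inv ?C) (?s y))"
    proof (rule smooth_on_compose[OF o oQ])
      show "smooth_on (chart_image c ?V) ?s" by (rule smooth_on_subset[OF s]) (auto simp: chart_image_def)
      show "smooth_on ?CQ (f \<circ> chart_inv ?C)" using Q(3) cchart_in[OF c T w] by (simp add: smooth_fun_def)
    qed (use im in blast)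
    then have "smooth_on (chart_image c ?V) (f \<circ> phase_point T w \<alpha> \<circ> chart_inv c)"
    proof (rule smooth_on_cong[OF o, rotated])
      fix y assume "y \<in> chart_image c ?V"
      then have "y \<in> chart_image c W" "\<alpha> (chart_inv c y) \<in> {- pi<..<pi}"
        by (auto simp: chart_image_eq[OF inj])
      then show "(f \<circ> chart_inv ?C) (?s y) = (f \<circ> phase_point T w \<alpha> \<circ> chart_inv c) y" using inv by simp
    qed
    then show ?thesis using o by blast
  qed
  have "openin (atlas_topology A) ?V" unfolding openin_open_charts[OF open_A] using key sub by blast
  then show ?thesis
    by (rule smooth_nearI) (use W(3) \<alpha>(2) Q(2) key in \<open>auto simp: smooth_fun_def\<close>)
qed

lemma differential_phase_point:
  assumes c: "c \<in> A" "z \<in> fst c"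
  shows "differential P (phase_point T w \<alpha>) z (tangent_vector A c z v) =
    tangent_vector P (cchart c T w) (phase_point T w \<alpha> z) (v, frechet_derivative (\<alpha> \<circ> chart_inv c) (at (snd c z)) v)"
proof
  fix f
  show "differential P (phase_point T w \<alpha>) z (tangent_vector A c z v) f =
    tangent_vector P (cchart c T w) (phase_point T w \<alpha> z) (v, frechet_derivative (\<alpha> \<circ> chart_inv c) (at (snd c z)) v) f"
  proof (cases "smooth_near P (phase_point T w \<alpha> z) f")
    case True
    let ?C = "cchart c T w"
    let ?s = "\<lambda>y. (y, \<alpha> (chart_inv c y))"
    have zT: "z \<in> fst T" using W by blast
    have inv_c: "chart_inv c (snd c z) = z" by (rule chart_inv_left[OF open_charts_inj[OF open_A c(1)] c(2)])
    have pC: "phase_point T w \<alpha> z \<in> fst ?C" "snd ?C (phase_point T w \<alpha> z) = ?s (snd c z)"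
      using cchart_coordinates[OF c(1) T w c(2) zT \<alpha>(2)] inv_c by (simp_all add: phase_point_def)
    have oW: "open (chart_image c W)" by (rule openin_chart_image[OF open_A W(1) c(1)])
    have yW: "snd c z \<in> chart_image c W" using c W(3) by (auto simp: chart_image_def)
    have sa: "smooth_on (chart_image c W) (\<alpha> \<circ> chart_inv c)" using \<alpha>(1) c by (simp add: smooth_fun_def)
    let ?S = "chart_image c W \<inter> (\<alpha> \<circ> chart_inv c) -` {- pi<..<pi}"
    have "continuous_on (chart_image c W) (\<alpha> \<circ> chart_inv c)"
      using sa unfolding smooth_on_def by (metis times_differentiable_on.simps(1))
    then have oS: "open ?S" by (rule continuous_open_preimage[OF _ oW open_greaterThanLessThan])
    have D\<alpha>: "(\<alpha> \<circ> chart_inv c has_derivative frechet_derivative (\<alpha> \<circ> chart_inv c) (at (snd c z))) (at (snd c z))"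
      by (rule smooth_on_has_derivative[OF sa yW])
    have Ds: "(?s has_derivative (\<lambda>v. (v, frechet_derivative (\<alpha> \<circ> chart_inv c) (at (snd c z)) v))) (at (snd c z))"
      using has_derivative_Pair[OF has_derivative_ident D\<alpha>] by (simp add: comp_def)
    have "(f \<circ> chart_inv ?C) differentiable at (snd ?C (phase_point T w \<alpha> z))"
      by (rule smooth_near_differentiable[OF open_P cchart_in[OF c(1) T w] pC(1) True])
    then have "(f \<circ> chart_inv ?C has_derivative frechet_derivative (f \<circ> chart_inv ?C) (at (snd ?C (phase_point T w \<alpha> z))))
        (at (?s (snd c z)))"
      using frechet_derivative_has pC(2) by metis
    note chain = has_derivative_compose[OF Ds this]
    have "frechet_derivative (f \<circ> phase_point T w \<alpha> \<circ> chart_inv c) (at (snd c z)) =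
        frechet_derivative (\<lambda>y. (f \<circ> chart_inv ?C) (?s y)) (at (snd c z))"
    proof (rule frechet_derivative_cong_open[OF oS])
      show "snd c z \<in> ?S" using yW \<alpha>(2) inv_c by simp
      fix y assume y: "y \<in> ?S"
      have "chart_inv ?C (?s y) = phase_point T w \<alpha> (chart_inv c y)"
        unfolding phase_point_def
        by (rule cchart_inv[OF c(1) T w]) (use y W(2) in \<open>auto simp: chart_image_def\<close>)
      then show "(f \<circ> phase_point T w \<alpha> \<circ> chart_inv c) y = (f \<circ> chart_inv ?C) (?s y)" by simp
    qed
    then show ?thesis
      using smooth_near_phase_point[OF True] True frechet_derivative_eq[OF chain]
      by (simp add: differential_def tangent_vector_def)
  next
    case False
    then show ?thesis by (simp add: differential_def tangent_vector_def)
  qed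
qed

end

section \<open>Vertical and horizontal vectors in coordinates\<close>

context
  fixes c T w y t
  assumes c: "c \<in> A" and T: "T \<in> trivializations L" and w: "cmod w = 1"
    and y: "y \<in> chart_image c (fst T)" and t: "t \<in> {- pi<..<pi}"
begin

abbreviation "pt \<equiv> chart_inv (cchart c T w) (y, t)"

lemma pt: "pt = circle_point T (chart_inv c y) (w * cis t)"
  by (rule cchart_inv[OF c T w y t])

lemma pt_base: "chart_inv c y \<in> fst c" "chart_inv c y \<in> fst T" "snd c (chart_inv c y) = y"
  using y chart_inv_left[OF open_charts_inj[OF open_A c]] by (auto simp: chart_image_def)

lemma pt_in: "pt \<in> fst (cchart c T w)" "snd (cchart c T w) pt = (y, t)" "pt \<in> circle_bundle A L h"
  "bundle_proj pt = chart_inv c y"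
  using cchart_coordinates[OF c T w pt_base(1,2) t] circle_point_in[OF T pt_base(2)] w
  by (simp_all add: pt pt_base bundle_proj_def fst_circle_point norm_mult)

text \<open>The orbit through the point is the coordinate line of the angle.\<close>

lemma action_generator_coordinates: "action_generator P pt = tangent_vector P (cchart c T w) pt (0, 1)"
proof
  fix f
  show "action_generator P pt f = tangent_vector P (cchart c T w) pt (0, 1) f"
  proof (cases "smooth_near P pt f")
    case True
    let ?F = "f \<circ> chart_inv (cchart c T w)"
    have D: "(?F has_derivative frechet_derivative ?F (at (y, t))) (at (y, t + 0))"
      using frechet_derivative_has[OF smooth_near_differentiable[OF open_P cchart_in[OF c T w] pt_in(1) True]]
      by (simp add: pt_in)
    have "((\<lambda>s. (y, t + s)) has_derivative (\<lambda>s. (0, s))) (at 0)"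
      by (auto intro!: derivative_eq_intros)
    note chain = has_derivative_compose[OF this D]
    have lin: "linear (frechet_derivative ?F (at (y, t)))" using D has_derivative_linear by blast
    have "frechet_derivative ?F (at (y, t)) (0, s) = s *\<^sub>R frechet_derivative ?F (at (y, t)) (0, 1)" for s
      using linear_scale[OF lin, of s "(0, 1)"] by simp
    then have V: "((\<lambda>s. ?F (y, t + s)) has_vector_derivative frechet_derivative ?F (at (y, t)) (0, 1)) (at 0)"
      unfolding has_vector_derivative_def by (intro has_derivative_eq_rhs[OF chain] ext)
    have e: "?F (y, t + s) = f (circle_action s pt)" if "s \<in> {- pi - t<..<pi - t}" for s
      using circle_action_coordinates[OF c T w y t, of s] that by simp
    have "(0::real) \<in> {- pi - t<..<pi - t}" using t by simp
    from has_vector_derivative_transform_within_open[OF V open_greaterThanLessThan this e]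
    have "((\<lambda>s. f (circle_action s pt)) has_vector_derivative frechet_derivative ?F (at (y, t)) (0, 1)) (at 0)" .
    then show ?thesis
      using True by (simp add: action_generator_def tangent_vector_def vector_derivative_at pt_in)
  next
    case False
    then show ?thesis by (simp add: action_generator_def tangent_vector_def)
  qed
qed

lemma differential_bundle_proj:
  "differential A bundle_proj pt (tangent_vector P (cchart c T w) pt v) =
    tangent_vector A c (chart_inv c y) (fst v)"
proof
  fix f
  show "differential A bundle_proj pt (tangent_vector P (cchart c T w) pt v) f =
    tangent_vector A c (chart_inv c y) (fst v) f"
  proof (cases "smooth_near A (chart_inv c y) f")
    case True
    then obtain W where W: "openin (atlas_topology A) W" "chart_inv c y \<in> W" "smooth_fun A W f"
      unfolding smooth_near_def by blast
    have "smooth_near P pt (f \<circ> bundle_proj)"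
      by (rule smooth_nearI[OF openin_preimage[OF W(1)]]) (use W pt_in smooth_fun_pullback[OF W(1)] in auto)
    moreover have "frechet_derivative (f \<circ> bundle_proj \<circ> chart_inv (cchart c T w)) (at (y, t)) =
        frechet_derivative (\<lambda>q. (f \<circ> chart_inv c) (fst q)) (at (y, t))"
    proof (rule frechet_derivative_cong_open)
      show "open (chart_image c (fst T) \<times> {- pi<..<pi})" using cchart_open[OF c T w] cchart_image[OF c T w] by simp
      show "(y, t) \<in> chart_image c (fst T) \<times> {- pi<..<pi}" using y t by simp
      fix q assume "q \<in> chart_image c (fst T) \<times> {- pi<..<pi}"
      then show "(f \<circ> bundle_proj \<circ> chart_inv (cchart c T w)) q = (f \<circ> chart_inv c) (fst q)"
        using cchart_inv[OF c T w, of "fst q" "snd q"] by (auto simp: bundle_proj_def fst_circle_point)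
    qed
    moreover have "(f \<circ> chart_inv c) differentiable at (fst (y, t))"
      using smooth_near_differentiable[OF open_A c pt_base(1) True] by (simp add: pt_base)
    ultimately show ?thesis
      using True frechet_derivative_fst[of "f \<circ> chart_inv c" "(y, t)" v]
      by (simp add: differential_def tangent_vector_def pt_in pt_base)
  next
    case False
    then show ?thesis by (simp add: differential_def tangent_vector_def pt_in)
  qed
qed

end

end

section \<open>The Kaluza-Klein metric in coordinates\<close>

locale kaluza_klein_bundle = hermitian_line_bundle A L h
  for A :: "('x, complex) chart set" and L :: "('x, 'l) line_bundle" and h :: "'x \<Rightarrow> 'l \<Rightarrow> 'l \<Rightarrow> complex" +
  fixes g :: "'x metric_field" and nabla :: "('x, 'l) covariant_derivative"
    and G :: "('x \<times> ('l \<Rightarrow> complex)) metric_field"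
  assumes g: "riemannian_metric A g" and nabla: "metric_connection A L h nabla"
    and G: "kaluza_klein_metric A g L h nabla G"
begin

lemmas connection_at = nabla[unfolded metric_connection_def connection_def, THEN conjunct1, THEN conjunct1,
    THEN bspec, THEN spec, THEN mp, THEN bspec]
lemmas connection_local = connection_at[THEN conjunct2, THEN conjunct2, THEN conjunct2, THEN conjunct1,
    THEN spec, THEN spec, THEN mp]
lemmas connection_leibniz = connection_at[THEN conjunct2, THEN conjunct2, THEN conjunct2, THEN conjunct2,
    THEN conjunct2, THEN spec, THEN mp]
lemmas connection_smooth = nabla[unfolded metric_connection_def connection_def, THEN conjunct1, THEN conjunct2,
    THEN spec, THEN spec, THEN spec, THEN spec, THEN mp]
lemmas connection_metric = nabla[unfolded metric_connection_def, THEN conjunct2, THEN bspec, THEN spec, THEN spec,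
    THEN mp, THEN bspec]
lemmas kaluza_klein = G[unfolded kaluza_klein_metric_def Let_def]
lemmas G_riemannian = kaluza_klein[THEN conjunct1]
lemmas G_at = kaluza_klein[THEN conjunct2, THEN bspec, THEN conjunct2]

definition connection_form where
  "connection_form c T y v =
     snd T (chart_inv c y) (nabla (frame T) (chart_inv c y) (tangent_vector A c (chart_inv c y) v))"

context
  fixes c T y
  assumes c: "c \<in> A" and T: "T \<in> trivializations L" and y: "y \<in> chart_image c (fst T)"
begin

abbreviation "foot \<equiv> chart_inv c y"

lemma base: "foot \<in> fst c" "foot \<in> fst T" "snd c foot = y" "foot \<in> carrier_of A"
  using y chart_inv_left[OF open_charts_inj[OF open_A c]] c by (auto simp: chart_image_def carrier_of_def)

lemmas base_tangent = tangent_vector_in[OF c base(1)]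
lemmas near_frame = smooth_section_near_frame[OF T base(2)]
lemmas connection_frame = connection_at[OF base(4) near_frame base_tangent]

lemma nabla_frame_in: "nabla (frame T) foot (tangent_vector A c foot v) \<in> fibre L foot"
  using connection_frame by blast

lemma nabla_frame:
  "nabla (frame T) foot (tangent_vector A c foot v) = fibre_scale L foot (connection_form c T y v) (frame T foot)"
  unfolding connection_form_def by (rule fibre_frame[OF T base(2) nabla_frame_in])

lemma linear_connection_form: "linear (connection_form c T y)"
proof (rule linearI)
  fix v v'
  have "nabla (frame T) foot (tangent_add (tangent_vector A c foot v) (tangent_vector A c foot v')) =
    fibre_add L foot (nabla (frame T) foot (tangent_vector A c foot v)) (nabla (frame T) foot (tangent_vector A c foot v'))"
    using connection_frame[of v] base_tangent[of v'] by blast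
  then show "connection_form c T y (v + v') = connection_form c T y v + connection_form c T y v'"
    unfolding connection_form_def tangent_vector_add[OF open_A c base(1)]
    by (simp add: trivialization_add[OF T base(2) nabla_frame_in nabla_frame_in])
next
  fix r v
  have "nabla (frame T) foot (tangent_scale r (tangent_vector A c foot v)) =
    fibre_scale L foot (of_real r) (nabla (frame T) foot (tangent_vector A c foot v))"
    using connection_frame[of v] by blast
  then show "connection_form c T y (r *\<^sub>R v) = r *\<^sub>R connection_form c T y v"
    unfolding connection_form_def tangent_vector_scale[OF open_A c base(1)]
    by (simp add: trivialization_scale[OF T base(2) nabla_frame_in] scaleR_conv_of_real)
qed

text \<open>Compatibility with \<open>h\<close> fixes the real part of the connection form: differentiating
  \<open>h e e = \<rho>\<^sup>2\<close> gives \<open>2 \<rho> \<rho>' = 2 \<rho>\<^sup>2 Re a\<close>, where \<open>\<nabla> e = a e\<close> and \<open>\<rho>\<close> is the norm of the frame \<open>e\<close>.\<close>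

lemma frame_norm_derivative:
  shows "frechet_derivative (frame_norm T \<circ> chart_inv c) (at y) v =
    frame_norm T foot * Re (connection_form c T y v)"
proof -
  let ?S = "chart_image c (fst T)" and ?a = "connection_form c T y v" and ?e = "frame T foot"
  let ?N = "frame_norm T \<circ> chart_inv c"
  let ?H = "\<lambda>u. h u (frame T u) (frame T u)"
  note oT = trivialization_openin[OF T]
  have oS: "open ?S" by (rule openin_chart_image[OF open_A oT c])
  have sN: "smooth_on ?S ?N" using smooth_frame_norm[OF T] c by (simp add: smooth_fun_def)
  have sH: "smooth_fun A (fst T) ?H"
    using h smooth_section_frame[OF T] oT unfolding hermitian_metric_def by blast
  have e: "?e \<in> fibre L foot" by (rule frame_in[OF T base(2)])
  have "complex_derivative (tangent_vector A c foot v) ?H =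
      h foot (nabla (frame T) foot (tangent_vector A c foot v)) ?e + h foot ?e (nabla (frame T) foot (tangent_vector A c foot v))"
    by (rule connection_metric[OF base(4) _ base_tangent]) (use near_frame in blast)
  also have "\<dots> = of_real (2 * Re ?a * (frame_norm T foot)\<^sup>2)"
    unfolding nabla_frame hermitian_scale[OF T base(2) e e] frame_norm_sq[OF T base(2)]
    by (simp add: complex_eq_iff algebra_simps)
  finally have 1: "complex_derivative (tangent_vector A c foot v) ?H = of_real (2 * Re ?a * (frame_norm T foot)\<^sup>2)" .
  have DN: "(?N has_derivative frechet_derivative ?N (at y)) (at y)"
    by (rule smooth_on_has_derivative[OF sN y])
  have "((\<lambda>q. of_real ((?N q)\<^sup>2) :: complex) has_derivative
      (\<lambda>v. of_real (2 * ?N y * frechet_derivative ?N (at y) v))) (at y)"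
    by (rule has_derivative_of_real) (use has_derivative_power[OF DN, of 2] in \<open>simp add: mult_ac\<close>)
  then have "frechet_derivative (\<lambda>q. of_real ((?N q)\<^sup>2) :: complex) (at y) v =
      of_real (2 * ?N y * frechet_derivative ?N (at y) v)"
    by (rule frechet_derivative_eq)
  moreover have "frechet_derivative (?H \<circ> chart_inv c) (at y) =
      frechet_derivative (\<lambda>q. of_real ((?N q)\<^sup>2) :: complex) (at y)"
    by (rule frechet_derivative_cong_open[OF oS y])
      (use chart_image_inv[OF open_charts_inj[OF open_A c]] frame_norm_sq[OF T] in auto)
  moreover have "complex_derivative (tangent_vector A c foot v) ?H = frechet_derivative (?H \<circ> chart_inv c) (at y) v"
    using complex_derivative_tangent_vector[OF open_A c base(1) oT base(2) sH] base(3) by simp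
  ultimately have "complex_of_real (2 * ?N y * frechet_derivative ?N (at y) v) = of_real (2 * Re ?a * (frame_norm T foot)\<^sup>2)"
    using 1 by simp
  then have "2 * ?N y * frechet_derivative ?N (at y) v = 2 * Re ?a * (frame_norm T foot)\<^sup>2"
    by (simp only: of_real_eq_iff)
  then show ?thesis using frame_norm_pos[OF T base(2)] by (simp add: power2_eq_square)
qed

text \<open>The value \<open>q\<close> of the dual section on the frame \<open>e\<close> is \<open>\<rho> w cis \<alpha>\<close>; its logarithmic derivative is
  \<open>\<rho>' / \<rho> + \<i> \<alpha>'\<close>, which is the connection form \<open>a\<close> because the real parts agree by the previous
  lemma and the imaginary parts by assumption. For a section \<open>s = f e\<close> both the derivative of
  \<open>\<sigma> s = q f\<close> and \<open>\<sigma> (\<nabla> s)\<close> are then \<open>q (f' + f a)\<close>.\<close>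

lemma dual_parallel_phase:
  assumes w: "cmod w = 1" and W: "openin (atlas_topology A) W" "W \<subseteq> fst T" "foot \<in> W"
    and \<alpha>: "smooth_fun A W \<alpha>"
    and d\<alpha>: "frechet_derivative (\<alpha> \<circ> chart_inv c) (at y) v = Im (connection_form c T y v)"
  shows "dual_parallel_at A L nabla (\<lambda>u. snd (phase_point T w \<alpha> u)) foot (tangent_vector A c foot v)"
  unfolding dual_parallel_at_def
proof (intro allI impI)
  fix s assume s: "smooth_section_near A L foot s"
  let ?D = "tangent_vector A c foot v" and ?e = "frame T foot" and ?a = "connection_form c T y v"
  obtain Q where Q: "openin (atlas_topology A) Q" "foot \<in> Q" "smooth_section A L Q s"
    using s unfolding smooth_section_near_def by blast
  let ?V = "Q \<inter> W"
  have V: "openin (atlas_topology A) ?V" "foot \<in> ?V" "?V \<subseteq> fst T" using Q(1,2) W by (auto intro: openin_Int)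
  define f where "f u = snd T u (s u)" for u
  define q where "q u = of_real (frame_norm T u) * (w * cis (\<alpha> u))" for u
  have sin: "s u \<in> fibre L u" if "u \<in> Q" for u using Q(3) that unfolding smooth_section_def by blast
  have sf: "smooth_fun A ?V f"
  proof -
    have "smooth_fun A (Q \<inter> fst T) (\<lambda>u. snd T u (s u))"
      using Q(3) T unfolding smooth_section_def case_prod_unfold by blast
    then show ?thesis unfolding f_def by (rule smooth_fun_subset) (use W(2) in blast)
  qed
  have sr: "smooth_fun A ?V (\<lambda>u. complex_of_real (frame_norm T u))"
    by (rule smooth_fun_linear[OF open_A V(1) smooth_fun_subset[OF smooth_frame_norm[OF T] V(3)] bounded_linear_of_real])
  have sa: "smooth_fun A ?V \<alpha>" by (rule smooth_fun_subset[OF \<alpha>]) simp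
  have sc: "smooth_fun A ?V (\<lambda>u. cis (\<alpha> u))"
    by (rule smooth_fun_compose[OF open_A V(1) sa open_UNIV _ smooth_on_cis]) simp
  have sq: "smooth_fun A ?V q"
    unfolding q_def by (intro smooth_fun_mult V(1) sr sc smooth_fun_const)
  have sfq: "smooth_fun A ?V (\<lambda>u. q u * f u)" by (rule smooth_fun_mult[OF V(1) sq sf])
  have eval: "snd (phase_point T w \<alpha> u) l = q u * snd T u l" if "l \<in> fibre L u" for u l
    using that by (simp add: phase_point_def circle_point_def q_def)
  have ss: "smooth_fun A ?V (\<lambda>u. snd (phase_point T w \<alpha> u) (s u))"
    by (rule smooth_fun_cong[OF open_A V(1) _ sfq]) (simp add: eval sin f_def)
  have yV: "y \<in> chart_image c ?V"
    using V(2) base by (auto simp: chart_image_def intro!: image_eqI[of _ _ foot])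
  have oV: "open (chart_image c ?V)" by (rule openin_chart_image[OF open_A V(1) c])
  have Dsm: "(F \<circ> chart_inv c has_derivative frechet_derivative (F \<circ> chart_inv c) (at y)) (at y)"
    if "smooth_fun A ?V F" for F :: "'x \<Rightarrow> 'b::real_normed_vector"
    using that c smooth_on_has_derivative[OF _ yV] unfolding smooth_fun_def by blast
  let ?f' = "frechet_derivative (f \<circ> chart_inv c) (at y) v"
  have Df: "complex_derivative ?D f = ?f'"
    using complex_derivative_tangent_vector[OF open_A c base(1) V(1,2) sf] base(3) by simp
  have Dq: "frechet_derivative (q \<circ> chart_inv c) (at y) v = q foot * ?a"
  proof -
    have N: "(frame_norm T \<circ> chart_inv c has_derivative frechet_derivative (frame_norm T \<circ> chart_inv c) (at y)) (at y)"
      by (rule Dsm[OF smooth_fun_subset[OF smooth_frame_norm[OF T] V(3)]])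
    have "(cis has_derivative (\<lambda>v. of_real v * (\<i> * cis x))) (at x)" for x
      by (auto intro!: derivative_eq_intros simp: scaleR_conv_of_real)
    note C = has_derivative_compose[OF Dsm[OF sa] this]
    have DQ: "((\<lambda>x. of_real ((frame_norm T \<circ> chart_inv c) x) * (w * cis ((\<alpha> \<circ> chart_inv c) x))) has_derivative
      (\<lambda>v. of_real ((frame_norm T \<circ> chart_inv c) y) * (w * (of_real (frechet_derivative (\<alpha> \<circ> chart_inv c) (at y) v) *
          (\<i> * cis ((\<alpha> \<circ> chart_inv c) y)))) +
        of_real (frechet_derivative (frame_norm T \<circ> chart_inv c) (at y) v) * (w * cis ((\<alpha> \<circ> chart_inv c) y)))) (at y)"
      by (rule has_derivative_mult[OF has_derivative_of_real[OF N] has_derivative_mult_right[OF C]])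
    have "frechet_derivative (q \<circ> chart_inv c) (at y) v =
      of_real (frame_norm T foot) * (w * (of_real (Im ?a) * (\<i> * cis (\<alpha> foot)))) +
        of_real (frame_norm T foot * Re ?a) * (w * cis (\<alpha> foot))"
      using frechet_derivative_eq[OF DQ, of v]
      by (simp add: q_def comp_def d\<alpha>[unfolded comp_def] frame_norm_derivative[unfolded comp_def])
    also have "\<dots> = q foot * (of_real (Re ?a) + \<i> * of_real (Im ?a))"
      by (simp add: q_def algebra_simps)
    also have "\<dots> = q foot * ?a" by (simp only: complex_eq[symmetric])
    finally show ?thesis .
  qed
  have "complex_derivative ?D (\<lambda>u. snd (phase_point T w \<alpha> u) (s u)) =
      frechet_derivative ((\<lambda>u. snd (phase_point T w \<alpha> u) (s u)) \<circ> chart_inv c) (at y) v"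
    using complex_derivative_tangent_vector[OF open_A c base(1) V(1,2) ss] base(3) by simp
  also have "\<dots> = frechet_derivative (\<lambda>x. (q \<circ> chart_inv c) x * (f \<circ> chart_inv c) x) (at y) v"
  proof -
    have "frechet_derivative ((\<lambda>u. snd (phase_point T w \<alpha> u) (s u)) \<circ> chart_inv c) (at y) =
        frechet_derivative (\<lambda>x. (q \<circ> chart_inv c) x * (f \<circ> chart_inv c) x) (at y)"
      by (rule frechet_derivative_cong_open[OF oV yV])
        (use chart_image_inv[OF open_charts_inj[OF open_A c], of _ ?V] sin eval in \<open>auto simp: f_def\<close>)
    then show ?thesis by simp
  qed
  also have "\<dots> = q foot * ?f' + q foot * ?a * f foot"
    using frechet_derivative_eq[OF has_derivative_mult[OF Dsm[OF sq] Dsm[OF sf]]] Dq by simp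
  finally have 1: "complex_derivative ?D (\<lambda>u. snd (phase_point T w \<alpha> u) (s u)) = q foot * (?f' + f foot * ?a)"
    by (simp add: algebra_simps)
  have e: "?e \<in> fibre L foot" by (rule frame_in[OF T base(2)])
  have "nabla s foot ?D = nabla (\<lambda>u. fibre_scale L u (f u) (frame T u)) foot ?D"
  proof -
    have "\<forall>u\<in>?V. fibre_scale L u (f u) (frame T u) = s u"
      using fibre_frame[OF T] sin V(3) by (metis IntD1 f_def subsetD)
    then have "nabla (\<lambda>u. fibre_scale L u (f u) (frame T u)) foot ?D = nabla s foot ?D"
      using V(1,2) by (intro connection_local[OF base(4) s base_tangent, of ?V]) simp
    then show ?thesis by simp
  qed
  also have "\<dots> = fibre_add L foot (fibre_scale L foot (complex_derivative ?D f) ?e) (fibre_scale L foot (f foot) (nabla (frame T) foot ?D))"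
    by (rule connection_leibniz[OF base(4) near_frame base_tangent smooth_nearI[OF V(1,2) sf]])
  finally have n: "nabla s foot ?D = \<dots>" .
  have i: "fibre_scale L foot (complex_derivative ?D f) ?e \<in> fibre L foot"
      "fibre_scale L foot (f foot) (nabla (frame T) foot ?D) \<in> fibre L foot"
    by (rule fibre_scale_in[OF base(4) e], rule fibre_scale_in[OF base(4) nabla_frame_in])
  have "snd T foot (nabla s foot ?D) = ?f' + f foot * ?a"
    unfolding n
    unfolding trivialization_add[OF T base(2) i] trivialization_scale[OF T base(2) e]
      trivialization_scale[OF T base(2) nabla_frame_in] frame_1[OF T base(2)]
    unfolding Df connection_form_def by simp
  moreover have "nabla s foot ?D \<in> fibre L foot" using n i fibre_add_in[OF base(4)] by simp
  ultimately have "snd (phase_point T w \<alpha> foot) (nabla s foot ?D) = q foot * (?f' + f foot * ?a)" using eval by simp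
  then show "complex_derivative ?D (\<lambda>u. snd (phase_point T w \<alpha> u) (s u)) - snd (phase_point T w \<alpha> foot) (nabla s foot ?D) = 0"
    using 1 by simp
qed

lemma smooth_unit_dual_section_phase:
  assumes w: "cmod w = 1" and W: "openin (atlas_topology A) W" "W \<subseteq> fst T" "foot \<in> W"
    and \<alpha>: "smooth_fun A W \<alpha>"
  shows "smooth_unit_dual_section_near A L h foot (\<lambda>u. snd (phase_point T w \<alpha> u))"
  unfolding smooth_unit_dual_section_near_def case_prod_unfold
proof (intro exI[of _ W] conjI ballI W)
  fix u assume u: "u \<in> W"
  have "phase_point T w \<alpha> u \<in> circle_bundle A L h"
    unfolding phase_point_def using circle_point_in[OF T, of u] u W(2) w by (auto simp: norm_mult)
  then show "(u, snd (phase_point T w \<alpha> u)) \<in> circle_bundle A L h"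
    by (simp add: phase_point_def circle_point_def)
next
  fix T' assume T': "T' \<in> trivializations L"
  obtain t where t: "smooth_fun A (fst T' \<inter> fst T) t"
    "\<And>x u. x \<in> fst T' \<inter> fst T \<Longrightarrow> u \<in> fibre L x \<Longrightarrow> snd T x u = t x * snd T' x u"
    using trivialization_transition[OF T' T] by blast
  let ?V = "W \<inter> fst T'"
  have V: "openin (atlas_topology A) ?V" "?V \<subseteq> fst T" "?V \<subseteq> fst T' \<inter> fst T"
    using W trivialization_openin[OF T'] by (auto intro: openin_Int)
  have sr: "smooth_fun A ?V (\<lambda>u. complex_of_real (frame_norm T u))"
    by (rule smooth_fun_linear[OF open_A V(1) smooth_fun_subset[OF smooth_frame_norm[OF T] V(2)] bounded_linear_of_real])
  have sa: "smooth_fun A ?V \<alpha>" by (rule smooth_fun_subset[OF \<alpha>]) simp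
  have sc: "smooth_fun A ?V (\<lambda>u. cis (\<alpha> u))"
    by (rule smooth_fun_compose[OF open_A V(1) sa open_UNIV _ smooth_on_cis]) simp
  have "smooth_fun A ?V (\<lambda>u. of_real (frame_norm T u) * (w * cis (\<alpha> u)) * t u)"
    by (intro smooth_fun_mult V(1) sr sc smooth_fun_const smooth_fun_subset[OF t(1) V(3)])
  then show "smooth_fun A ?V (\<lambda>u. snd (phase_point T w \<alpha> u) (frame T' u))"
    by (rule smooth_fun_cong[OF open_A V(1), rotated])
      (use t(2) frame_in[OF T'] frame_1[OF T'] V(3) in \<open>auto simp: phase_point_def circle_point_def\<close>)
qed

end

lemma smooth_connection_form:
  assumes "c \<in> A" "T \<in> trivializations L"
  shows "smooth_on (chart_image c (fst T)) (\<lambda>y. connection_form c T y v)"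
proof -
  have "smooth_section A L (fst T \<inter> fst c) (\<lambda>z. nabla (frame T) z (tangent_vector A c z v))"
    by (rule connection_smooth) (use smooth_section_frame trivialization_openin assms in blast)
  then have "smooth_fun A (fst T \<inter> fst c \<inter> fst T) (\<lambda>z. snd T z (nabla (frame T) z (tangent_vector A c z v)))"
    using assms(2) unfolding smooth_section_def case_prod_unfold by blast
  moreover have "chart_image c (fst T \<inter> fst c \<inter> fst T) = chart_image c (fst T)" by (auto simp: chart_image_def)
  ultimately have "smooth_on (chart_image c (fst T))
      ((\<lambda>z. snd T z (nabla (frame T) z (tangent_vector A c z v))) \<circ> chart_inv c)"
    using assms(1) unfolding smooth_fun_def by (metis (lifting))
  then show ?thesis by (simp add: connection_form_def comp_def)
qed

context
  fixes c T w y t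
  assumes c: "c \<in> A" and T: "T \<in> trivializations L" and w: "cmod w = 1"
    and y: "y \<in> chart_image c (fst T)" and t: "t \<in> {- pi<..<pi}"
begin

abbreviation "\<beta> v \<equiv> Im (connection_form c T y v)"
abbreviation "p0 \<equiv> chart_inv (cchart c T w) (y, t)"

lemma linear_\<beta>: "linear (\<lambda>v. Im (connection_form c T y v))"
  using linear_compose[OF linear_connection_form[OF c T y], of Im] bounded_linear_Im[THEN bounded_linear.linear]
  by (simp add: comp_def)

text \<open>Only the first derivative of the phase at the point matters, so a phase that is affine in the
  coordinates, with slope \<open>\<beta>\<close>, gives a section that is parallel in every direction at the point.\<close>

lemma horizontal_lift: "tangent_vector P (cchart c T w) p0 (v, \<beta> v) \<in> horizontal_space A L h nabla p0"
proof -
  note b = base[OF c T y]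
  let ?z = "chart_inv c y" and ?k = "Complex (\<beta> 1) (\<beta> \<i>)" and ?W = "fst c \<inter> fst T"
  define \<alpha> where "\<alpha> u = t + (snd c u - y) \<bullet> ?k" for u
  have \<beta>k: "v \<bullet> ?k = \<beta> v" for v
  proof -
    have "v = Re v *\<^sub>R 1 + Im v *\<^sub>R \<i>" by (simp add: complex_eq_iff)
    then have "\<beta> v = \<beta> (Re v *\<^sub>R 1 + Im v *\<^sub>R \<i>)" by simp
    also have "\<dots> = Re v * \<beta> 1 + Im v * \<beta> \<i>" using linear_add[OF linear_\<beta>] linear_scale[OF linear_\<beta>] by simp
    finally show ?thesis by (simp add: inner_complex_def)
  qed
  have W: "openin (atlas_topology A) ?W" "?W \<subseteq> fst T" "?z \<in> ?W"
    using complex_atlas_openin_chart[OF A c] trivialization_openin[OF T] b by (auto intro: openin_Int)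
  have \<alpha>: "smooth_fun A ?W \<alpha>"
    unfolding \<alpha>_def
  proof (rule complex_atlas_smooth_fun_chart[OF A c open_UNIV _ W(1)])
    show "smooth_on UNIV (\<lambda>q. t + (q - y) \<bullet> ?k)"
      by (intro smooth_on_add smooth_on_const smooth_on_bilinear[OF bounded_bilinear_inner]
          smooth_on_diff smooth_on_bounded_linear[OF bounded_linear_ident] open_UNIV)
  qed auto
  have \<alpha>z: "\<alpha> ?z = t" using b by (simp add: \<alpha>_def)
  have d\<alpha>: "frechet_derivative (\<alpha> \<circ> chart_inv c) (at y) v = \<beta> v" for v
  proof -
    have yc: "y \<in> snd c ` fst c" using y by (auto simp: chart_image_def)
    have e: "frechet_derivative (\<alpha> \<circ> chart_inv c) (at y) = frechet_derivative (\<lambda>q. t + (q - y) \<bullet> ?k) (at y)"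
      by (rule frechet_derivative_cong_open[OF open_charts_open[OF open_A c] yc])
        (auto simp: \<alpha>_def chart_inv_left[OF open_charts_inj[OF open_A c]])
    have "((\<lambda>q. t + (q - y) \<bullet> ?k) has_derivative (\<lambda>v. v \<bullet> ?k)) (at y)"
      by (auto intro!: derivative_eq_intros)
    note D = this
    show ?thesis unfolding e frechet_derivative_eq[OF D] by (rule \<beta>k)
  qed
  have p0: "phase_point T w \<alpha> ?z = p0"
    unfolding phase_point_def \<alpha>z by (rule cchart_inv[OF c T w y t, symmetric])
  have sec: "phase_point T w \<alpha> = (\<lambda>u. (u, snd (phase_point T w \<alpha> u)))"
    by (rule ext) (simp add: phase_point_def circle_point_def)
  have fp: "fst p0 = ?z" using p0 by (metis phase_point_def fst_circle_point)
  have "tangent_vector P (cchart c T w) p0 (v, \<beta> v) =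
      differential P (phase_point T w \<alpha>) ?z (tangent_vector A c ?z v)"
    using differential_phase_point[OF T w W \<alpha>, unfolded \<alpha>z, OF t c b(1), of v] d\<alpha> p0 b(3) by simp
  also have "\<dots> = differential P (\<lambda>u. (u, snd (phase_point T w \<alpha> u))) (fst p0) (tangent_vector A c ?z v)"
    using sec fp by simp
  finally have h1: "tangent_vector P (cchart c T w) p0 (v, \<beta> v) =
    differential P (\<lambda>u. (u, snd (phase_point T w \<alpha> u))) (fst p0) (tangent_vector A c ?z v)" .
  have h2: "smooth_unit_dual_section_near A L h (fst p0) (\<lambda>u. snd (phase_point T w \<alpha> u))"
    unfolding fp by (rule smooth_unit_dual_section_phase[OF c T y w W \<alpha>])
  have h3: "snd (phase_point T w \<alpha> (fst p0)) = snd p0" using p0 fp by simp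
  have h4: "tangent_vector A c ?z v \<in> tangent_space A (fst p0)"
    unfolding fp by (rule tangent_vector_in[OF c b(1)])
  have h5: "dual_parallel_at A L nabla (\<lambda>u. snd (phase_point T w \<alpha> u)) (fst p0) (tangent_vector A c ?z v)"
    unfolding fp by (rule dual_parallel_phase[OF c T y w W \<alpha> d\<alpha>])
  show ?thesis
    unfolding horizontal_space_def
    by (intro CollectI exI[of _ "\<lambda>u. snd (phase_point T w \<alpha> u)"] exI[of _ "tangent_vector A c ?z v"] conjI h1 h2 h3 h4 h5)
qed

text \<open>The vector \<open>(v, r)\<close> is the sum of the horizontal \<open>(v, \<beta> v)\<close> and of \<open>r - \<beta> v\<close> times the generator.\<close>

lemma metric_in_chart_kaluza_klein:
  "metric_in_chart P G (cchart c T w) (y, t) (v, r) (v', r') =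
    metric_in_chart A g c y v v' + (r - \<beta> v) * (r' - \<beta> v')"
proof -
  note q = pt_in[OF c T w y t]
  let ?C = "cchart c T w"
  let ?M = "metric_in_chart P G ?C (y, t)"
  have C: "?C \<in> P" by (rule cchart_in[OF c T w])
  have yt: "(y, t) \<in> snd ?C ` fst ?C" using y t cchart_image[OF c T w] by simp
  note lin = linear_metric_in_chart[OF G_riemannian open_P C yt]
  note sym = metric_in_chart_sym[OF G_riemannian C yt]
  have gen: "action_generator P p0 = tangent_vector P ?C p0 (0, 1)"
    by (rule action_generator_coordinates[OF c T w y t])
  have "action_generator P p0 = tangent_scale 1 (action_generator P p0)" by (simp add: tangent_scale_def)
  then have ver: "tangent_vector P ?C p0 (0, 1) \<in> vertical_space P p0"
    unfolding vertical_space_def gen[symmetric] by (metis rangeI)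
  have hh: "?M (v, \<beta> v) (v', \<beta> v') = metric_in_chart A g c y v v'" for v v'
  proof -
    have "G p0 (tangent_vector P ?C p0 (v, \<beta> v)) (tangent_vector P ?C p0 (v', \<beta> v')) =
      g (bundle_proj p0) (differential A bundle_proj p0 (tangent_vector P ?C p0 (v, \<beta> v)))
        (differential A bundle_proj p0 (tangent_vector P ?C p0 (v', \<beta> v')))"
      using G_at[OF q(3)] horizontal_lift by blast
    then show ?thesis
      unfolding differential_bundle_proj[OF c T w y t] q(4) metric_in_chart_def by simp
  qed
  have hv: "?M (v, \<beta> v) (0, 1) = 0" for v
    unfolding metric_in_chart_def using G_at[OF q(3)] horizontal_lift ver by blast
  have vv: "?M (0, 1) (0, 1) = 1"
    unfolding metric_in_chart_def gen[symmetric] using G_at[OF q(3)] by blast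
  have dec: "(v, r) = (v, \<beta> v) + (r - \<beta> v) *\<^sub>R (0, 1)" for v :: complex and r by simp
  have ex: "?M (v, r) x = ?M (v, \<beta> v) x + (r - \<beta> v) * ?M (0, 1) x" for v r x
    using dec[of v r] linear_add[OF lin] linear_scale[OF lin] by (metis real_scaleR_def)
  have "?M (v, r) (v', r') = ?M (v', r') (v, \<beta> v) + (r - \<beta> v) * ?M (v', r') (0, 1)"
    by (simp only: ex[of v r] sym[of "(v, \<beta> v)" "(v', r')"] sym[of "(0, 1)" "(v', r')"])
  also have "?M (v', r') (v, \<beta> v) = metric_in_chart A g c y v v'"
    using hh[of v v'] hv[of v]
    by (simp add: ex[of v' r'] sym[of "(0, 1)" "(v, \<beta> v)"] sym[of "(v', \<beta> v')" "(v, \<beta> v)"])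
  also have "?M (v', r') (0, 1) = r' - \<beta> v'"
    unfolding ex[of v' r'] hv vv by simp
  finally show ?thesis .
qed

end

end

section \<open>The Laplacian of a pullback\<close>

context kaluza_klein_bundle
begin

text \<open>In coordinates the Kaluza-Klein metric has the same volume density as \<open>g\<close>, and the gradient of a
  pullback is the horizontal lift of the gradient downstairs. None of the quantities depends on the
  angle, so the vertical component does not contribute to the divergence.\<close>

lemma laplacian_pullback:
  assumes c: "c \<in> A" and T: "T \<in> trivializations L" and w: "cmod w = 1"
    and y: "y \<in> chart_image c (fst T)" and t: "t \<in> {- pi<..<pi}"
    and \<psi>: "smooth_fun A (carrier_of A) \<psi>"
    and \<phi>: "\<And>p. p \<in> circle_bundle A L h \<Longrightarrow> \<phi> p = \<psi> (bundle_proj p)"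
  shows "laplacian_in_chart P G (cchart c T w) \<phi> (y, t) = laplacian_in_chart A g c \<psi> y"
proof -
  let ?C = "cchart c T w" and ?S = "chart_image c (fst T)" and ?I = "{- pi<..<pi}"
  define m where "m q = metric_in_chart A g c q" for q
  define l where "l q = frechet_derivative (\<psi> \<circ> chart_inv c) (at q)" for q
  define U where "U q = cramer (m q) (l q)" for q
  define V where "V q = sqrt (gram_det (m q))" for q
  define b where "b q v = Im (connection_form c T q v)" for q v
  have oS: "open ?S" by (rule openin_chart_image[OF open_A trivialization_openin[OF T] c])
  have oSI: "open (?S \<times> ?I)" by (intro open_Times oS open_greaterThanLessThan)
  have Sc: "q \<in> snd c ` fst c" if "q \<in> ?S" for q using that by (auto simp: chart_image_def)
  have planar: "planar_inner_product (m q)" if "q \<in> ?S" for q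
    unfolding m_def
  proof (rule planar_inner_product.intro)
    note q = Sc[OF that]
    show "linear (\<lambda>v. metric_in_chart A g c q v v')" for v' by (rule linear_metric_in_chart[OF g open_A c q])
    show "metric_in_chart A g c q v v' = metric_in_chart A g c q v' v" for v v'
      by (rule metric_in_chart_sym[OF g c q])
    show "metric_in_chart A g c q v v > 0" if "v \<noteq> 0" for v by (rule metric_in_chart_pos[OF g A c q that])
  qed
  have s\<psi>: "smooth_on ?S (\<psi> \<circ> chart_inv c)"
    using smooth_fun_subset[OF \<psi> trivialization_carrier[OF T]] c by (simp add: smooth_fun_def)
  have lin_l: "linear (l q)" if "q \<in> ?S" for q
    unfolding l_def by (rule has_derivative_linear[OF smooth_on_has_derivative[OF s\<psi> that]])
  have lin_b: "linear (b q)" if "q \<in> ?S" for q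
    unfolding b_def[abs_def] using linear_\<beta>[OF c T w that t] .
  have M: "metric_in_chart P G ?C (q, s) (v, r) (v', r') = m q v v' + (r - b q v) * (r' - b q v')"
    if "q \<in> ?S" "s \<in> ?I" for q s v r v' r'
    unfolding m_def b_def by (rule metric_in_chart_kaluza_klein[OF c T w that])
  have vol: "volume_density P G ?C q = V (fst q)" if "q \<in> ?S \<times> ?I" for q
  proof -
    have "gram_det (metric_in_chart P G ?C (fst q, snd q)) = gram_det (m (fst q))"
      by (rule planar_inner_product.gram_det_kaluza_klein[OF planar lin_b M]) (use that in auto)
    then show ?thesis by (simp add: volume_density_def V_def)
  qed
  have D\<phi>: "frechet_derivative (\<phi> \<circ> chart_inv ?C) (at q) v = l (fst q) (fst v)" if "q \<in> ?S \<times> ?I" for q v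
  proof -
    have "frechet_derivative (\<phi> \<circ> chart_inv ?C) (at q) = frechet_derivative (\<lambda>q. (\<psi> \<circ> chart_inv c) (fst q)) (at q)"
    proof (rule frechet_derivative_cong_open[OF oSI that])
      fix q assume "q \<in> ?S \<times> ?I"
      then have "fst q \<in> ?S" "snd q \<in> ?I" by auto
      from pt_in(3,4)[OF c T w this] show "(\<phi> \<circ> chart_inv ?C) q = (\<psi> \<circ> chart_inv c) (fst q)"
        using \<phi> by simp
    qed
    then show ?thesis
      unfolding l_def using frechet_derivative_fst[OF smooth_on_differentiable[OF s\<psi>], of q v] that by auto
  qed
  have grad: "gradient_in_chart P G ?C \<phi> q = (U (fst q), b (fst q) (U (fst q)))" if "q \<in> ?S \<times> ?I" for q
  proof -
    have q: "fst q \<in> ?S" "snd q \<in> ?I" using that by auto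
    have "(\<forall>v. metric_in_chart P G ?C (fst q, snd q) u v = l (fst q) (fst v)) \<longleftrightarrow>
        u = (U (fst q), b (fst q) (U (fst q)))" for u
      unfolding U_def
      by (rule planar_inner_product.kaluza_klein_gradient_iff[OF planar lin_b lin_l M]) (use q in auto)
    then show ?thesis unfolding gradient_in_chart_def D\<phi>[OF that] by simp
  qed
  have grad_A: "gradient_in_chart A g c \<psi> q = U q" if "q \<in> ?S" for q
    unfolding gradient_in_chart_def U_def l_def[symmetric] m_def[symmetric]
    using planar_inner_product.cramer_iff[OF planar[OF that] lin_l[OF that]] by simp
  have sm: "smooth_on ?S (\<lambda>q. m q v v')" for v v'
    unfolding m_def by (rule smooth_on_subset[OF smooth_on_metric_in_chart[OF g c]]) (use Sc in blast)
  have sl: "smooth_on ?S (\<lambda>q. l q v)" for v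
    unfolding l_def by (rule smooth_on_derivative[OF s\<psi>])
  have sb: "smooth_on ?S (\<lambda>q. b q v)" for v
    unfolding b_def by (rule smooth_on_linear_compose[OF bounded_linear_Im oS smooth_connection_form[OF c T]])
  have sd: "smooth_on ?S (\<lambda>q. gram_det (m q))"
    unfolding gram_det_complex by (intro smooth_on_diff smooth_on_mult oS sm)
  have pos: "(\<lambda>q. gram_det (m q)) ` ?S \<subseteq> {0<..}"
    using planar_inner_product.gram_det_pos[OF planar] by auto
  have sV: "smooth_on ?S V"
    unfolding V_def[abs_def] by (rule smooth_on_compose[OF oS open_greaterThan pos sd smooth_on_sqrt])
  have si: "smooth_on ?S (\<lambda>q. inverse (gram_det (m q)))"
    by (rule smooth_on_compose[OF oS open_greaterThan pos sd smooth_on_inverse])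
  have sR: "smooth_on ?S (\<lambda>q. Re (U q))" and sI: "smooth_on ?S (\<lambda>q. Im (U q))"
    unfolding U_def cramer_def complex.sel by (intro smooth_on_mult smooth_on_diff oS sm sl si)+
  \<comment> \<open>the components of density times gradient as functions on the base\<close>
  define F1 where "F1 q = V q * Re (U q)" for q
  define F2 where "F2 q = V q * Im (U q)" for q
  define F3 where "F3 q = V q * (Re (U q) * b q 1 + Im (U q) * b q \<i>)" for q
  have sF: "smooth_on ?S F1" "smooth_on ?S F2" "smooth_on ?S F3"
    unfolding F1_def[abs_def] F2_def[abs_def] F3_def[abs_def]
    by (intro smooth_on_mult smooth_on_add oS sV sR sI sb)+
  have bU: "b q (U q) = Re (U q) * b q 1 + Im (U q) * b q \<i>" if "q \<in> ?S" for q
  proof -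
    have "U q = Re (U q) *\<^sub>R 1 + Im (U q) *\<^sub>R \<i>" by (simp add: complex_eq_iff)
    then have "b q (U q) = b q (Re (U q) *\<^sub>R 1 + Im (U q) *\<^sub>R \<i>)" by simp
    then show ?thesis using linear_add[OF lin_b[OF that]] linear_scale[OF lin_b[OF that]] by simp
  qed
  let ?FP = "\<lambda>d q. volume_density P G ?C q * (gradient_in_chart P G ?C \<phi> q \<bullet> d)"
  let ?FA = "\<lambda>d q. volume_density A g c q * (gradient_in_chart A g c \<psi> q \<bullet> d)"
  have fP: "frechet_derivative (?FP d) (at (y, t)) v = frechet_derivative F (at y) (fst v)"
    if "smooth_on ?S F" "\<And>q. q \<in> ?S \<times> ?I \<Longrightarrow> ?FP d q = F (fst q)" for d F v
  proof -
    have "frechet_derivative (?FP d) (at (y, t)) = frechet_derivative (\<lambda>q. F (fst q)) (at (y, t))"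
      by (rule frechet_derivative_cong_open[OF oSI _ that(2)]) (use y t in auto)
    then show ?thesis
      using frechet_derivative_fst[of F "(y, t)" v] smooth_on_differentiable[OF that(1) y] by simp
  qed
  have fA: "frechet_derivative (?FA d) (at y) = frechet_derivative F (at y)"
    if "\<And>q. q \<in> ?S \<Longrightarrow> ?FA d q = F q" for d F
    by (rule frechet_derivative_cong_open[OF oS y that])
  have 1: "frechet_derivative (?FP (1, 0)) (at (y, t)) (1, 0) = frechet_derivative F1 (at y) 1"
    using fP[OF sF(1), of "(1, 0)" "(1, 0)"] by (simp add: vol grad F1_def inner_complex_def)
  have 2: "frechet_derivative (?FP (\<i>, 0)) (at (y, t)) (\<i>, 0) = frechet_derivative F2 (at y) \<i>"
    using fP[OF sF(2), of "(\<i>, 0)" "(\<i>, 0)"] by (simp add: vol grad F2_def inner_complex_def)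
  have 3: "frechet_derivative (?FP (0, 1)) (at (y, t)) (0, 1) = 0"
  proof -
    have "?FP (0, 1) q = F3 (fst q)" if "q \<in> ?S \<times> ?I" for q
      using that bU[of "fst q"] by (auto simp: vol grad F3_def)
    then have "frechet_derivative (?FP (0, 1)) (at (y, t)) (0, 1) = frechet_derivative F3 (at y) 0"
      using fP[OF sF(3), of "(0, 1)" "(0, 1)"] by simp
    also have "\<dots> = 0"
      by (rule linear_0[OF has_derivative_linear[OF smooth_on_has_derivative[OF sF(3) y]]])
    finally show ?thesis .
  qed
  have volA: "volume_density A g c q = V q" for q by (simp add: volume_density_def V_def m_def)
  have 4: "frechet_derivative (?FA 1) (at y) = frechet_derivative F1 (at y)"
    by (rule fA) (simp add: volA grad_A F1_def inner_complex_def)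
  have 5: "frechet_derivative (?FA \<i>) (at y) = frechet_derivative F2 (at y)"
    by (rule fA) (simp add: volA grad_A F2_def inner_complex_def)
  have 6: "(\<Sum>d\<in>Basis. frechet_derivative (?FA d) (at y) d) =
      frechet_derivative (?FA 1) (at y) 1 + frechet_derivative (?FA \<i>) (at y) \<i>"
    by (simp add: Basis_complex_def)
  have "laplacian_in_chart P G ?C \<phi> (y, t) =
      (frechet_derivative F1 (at y) 1 + frechet_derivative F2 (at y) \<i>) / V y"
    unfolding laplacian_in_chart_def Basis_complex_real using vol[of "(y, t)"] y t by (simp add: 1 2 3)
  also have "\<dots> = laplacian_in_chart A g c \<psi> y"
    unfolding laplacian_in_chart_def 6 4 5 unfolding volA ..
  finally show ?thesis .
qed

lemma has_laplacian_pullback: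
  assumes \<psi>: "smooth_fun A (carrier_of A) \<psi>"
    and \<phi>: "\<And>p. p \<in> circle_bundle A L h \<Longrightarrow> \<phi> p = \<psi> (bundle_proj p)"
  shows "has_laplacian P G \<phi> (\<lambda>p. - \<mu> * \<phi> p) \<longleftrightarrow> has_laplacian A g \<psi> (\<lambda>x. - \<mu> * \<psi> x)"
proof
  assume l: "has_laplacian P G \<phi> (\<lambda>p. - \<mu> * \<phi> p)"
  show "has_laplacian A g \<psi> (\<lambda>x. - \<mu> * \<psi> x)"
    unfolding has_laplacian_def
  proof (intro ballI)
    fix c x assume c: "c \<in> A" and x: "x \<in> fst c"
    then have "x \<in> carrier_of A" by (auto simp: carrier_of_def)
    then obtain T where T: "T \<in> trivializations L" "x \<in> fst T" using ex_trivialization by blast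
    have w: "cmod 1 = 1" by simp
    have y: "snd c x \<in> chart_image c (fst T)" using x T by (auto simp: chart_image_def)
    have t: "0 \<in> {- pi<..<pi}" by simp
    note p = pt_in[OF c T(1) w y t]
    have xx: "chart_inv c (snd c x) = x" by (rule chart_inv_left[OF open_charts_inj[OF open_A c] x])
    have "laplacian_in_chart A g c \<psi> (snd c x) = laplacian_in_chart P G (cchart c T 1) \<phi> (snd c x, 0)"
      by (rule laplacian_pullback[OF c T(1) w y t \<psi> \<phi>, symmetric])
    also have "\<dots> = - \<mu> * \<phi> (chart_inv (cchart c T 1) (snd c x, 0))"
      using l cchart_in[OF c T(1) w] p(1,2) unfolding has_laplacian_def by metis
    also have "\<dots> = - \<mu> * \<psi> x" using \<phi>[OF p(3)] p(4) xx by simp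
    finally show "laplacian_in_chart A g c \<psi> (snd c x) = - \<mu> * \<psi> x" .
  qed
next
  assume l: "has_laplacian A g \<psi> (\<lambda>x. - \<mu> * \<psi> x)"
  show "has_laplacian P G \<phi> (\<lambda>p. - \<mu> * \<phi> p)"
    unfolding has_laplacian_def
  proof (intro ballI)
    fix cc p assume "cc \<in> P" and p: "p \<in> fst cc"
    then obtain c T w where c: "c \<in> A" and T: "T \<in> trivializations L" and w: "cmod w = 1" and cc: "cc = cchart c T w"
      by (blast elim: P_cases)
    obtain z t where z: "z \<in> fst c" "z \<in> fst T" and t: "t \<in> {- pi<..<pi}" and pz: "p = circle_point T z (w * cis t)"
      using p cchart_point[OF c T w] unfolding cc by blast
    have y: "snd c z \<in> chart_image c (fst T)" using z by (auto simp: chart_image_def)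
    have sp: "snd cc p = (snd c z, t)" unfolding cc pz by (rule cchart_coordinates(2)[OF c T w z t])
    have pcb: "p \<in> circle_bundle A L h" using pz circle_point_in[OF T z(2)] w by (simp add: norm_mult)
    have "laplacian_in_chart P G cc \<phi> (snd cc p) = laplacian_in_chart A g c \<psi> (snd c z)"
      unfolding sp unfolding cc by (rule laplacian_pullback[OF c T w y t \<psi> \<phi>])
    also have "\<dots> = - \<mu> * \<psi> z" using l c z(1) by (simp add: has_laplacian_def)
    also have "\<dots> = - \<mu> * \<phi> p" using \<phi>[OF pcb] pz by (simp add: bundle_proj_def fst_circle_point)
    finally show "laplacian_in_chart P G cc \<phi> (snd cc p) = - \<mu> * \<phi> p" .
  qed
qed

lemma eigenfunction_pullback:
  assumes \<phi>: "\<And>p. p \<in> circle_bundle A L h \<Longrightarrow> \<phi> p = \<psi> (bundle_proj p)"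
  shows "eigenfunction P G \<phi> \<longleftrightarrow> eigenfunction A g \<psi>"
proof -
  have oP: "openin (atlas_topology P) (circle_bundle A L h)" using openin_topspace topspace_P by metis
  have oA: "openin (atlas_topology A) (carrier_of A)" using openin_topspace topspace_A by metis
  have pre: "{p \<in> circle_bundle A L h. bundle_proj p \<in> carrier_of A} = circle_bundle A L h"
    using bundle_proj_surj by blast
  have "smooth_fun P (circle_bundle A L h) \<phi> \<longleftrightarrow> smooth_fun P (circle_bundle A L h) (\<psi> \<circ> bundle_proj)"
    using smooth_fun_cong[OF open_P oP, of \<phi> "\<psi> \<circ> bundle_proj"] smooth_fun_cong[OF open_P oP, of "\<psi> \<circ> bundle_proj" \<phi>]
      \<phi> by auto
  also have "\<dots> \<longleftrightarrow> smooth_fun A (carrier_of A) \<psi>" using smooth_fun_pullback[OF oA, of \<psi>] unfolding pre .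
  finally have s: "smooth_fun P (circle_bundle A L h) \<phi> \<longleftrightarrow> smooth_fun A (carrier_of A) \<psi>" .
  have "(\<exists>p\<in>circle_bundle A L h. \<phi> p \<noteq> 0) \<longleftrightarrow> (\<exists>x\<in>carrier_of A. \<psi> x \<noteq> 0)"
    unfolding bundle_proj_surj[symmetric] using \<phi> by auto
  then show ?thesis
    unfolding eigenfunction_def carrier_P s using has_laplacian_pullback[of \<psi> \<phi>] \<phi> by auto
qed

text \<open>Weight zero says that the derivative along every orbit vanishes, and orbits are the fibres.\<close>

lemma weight_zero_iff:
  "has_weight (circle_bundle A L h) 0 (\<lambda>p. complex_of_real (\<phi> p)) \<longleftrightarrow>
    (\<exists>\<psi>. \<forall>p\<in>circle_bundle A L h. \<phi> p = \<psi> (bundle_proj p))"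
proof
  assume wt: "has_weight (circle_bundle A L h) 0 (\<lambda>p. complex_of_real (\<phi> p))"
  have const: "\<phi> (circle_action t p) = \<phi> p" if p: "p \<in> circle_bundle A L h" for t p
  proof -
    let ?f = "\<lambda>t. complex_of_real (\<phi> (circle_action t p))"
    have "(?f has_vector_derivative 0) (at s)" for s
    proof -
      have "((\<lambda>t. ?f (t + s)) has_vector_derivative 0) (at 0)"
        using bspec[OF wt[unfolded has_weight_def] circle_action_in[OF p, of s]] by (simp add: circle_action_add)
      then have "(((\<lambda>t. ?f (t + s)) \<circ> (\<lambda>t. t - s)) has_vector_derivative 1 *\<^sub>R 0) (at s)"
        by (intro vector_diff_chain_at) (auto intro!: derivative_eq_intros)
      then show ?thesis by (simp add: comp_def)
    qed
    then have d: "(?f has_vector_derivative 0) (at s within UNIV)" for s by simp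
    obtain k where "\<And>s. s \<in> UNIV \<Longrightarrow> ?f s = k"
      by (rule has_vector_derivative_zero_constant[OF convex_UNIV d]) blast
    then have "?f t = ?f 0" by (metis UNIV_I)
    moreover have "circle_action 0 p = p" by (simp add: circle_action_def)
    ultimately show ?thesis by simp
  qed
  have "\<phi> p = \<phi> (SOME q. q \<in> circle_bundle A L h \<and> bundle_proj q = bundle_proj p)"
    if p: "p \<in> circle_bundle A L h" for p
  proof -
    let ?q = "SOME q. q \<in> circle_bundle A L h \<and> bundle_proj q = bundle_proj p"
    have "?q \<in> circle_bundle A L h \<and> bundle_proj ?q = bundle_proj p"
      by (rule someI[of _ p]) (use p in simp)
    then obtain t where "?q = circle_action t p"
      using circle_action_fibre[OF p, of ?q] unfolding bundle_proj_def by auto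
    then show ?thesis using const[OF p] by metis
  qed
  then show "\<exists>\<psi>. \<forall>p\<in>circle_bundle A L h. \<phi> p = \<psi> (bundle_proj p)"
    by (intro exI[of _ "\<lambda>z. \<phi> (SOME q. q \<in> circle_bundle A L h \<and> bundle_proj q = z)"]) simp
next
  assume "\<exists>\<psi>. \<forall>p\<in>circle_bundle A L h. \<phi> p = \<psi> (bundle_proj p)"
  then obtain \<psi> where \<psi>: "\<And>p. p \<in> circle_bundle A L h \<Longrightarrow> \<phi> p = \<psi> (bundle_proj p)" by blast
  have "\<phi> (circle_action t p) = \<phi> p" if "p \<in> circle_bundle A L h" for t p
    using \<psi>[OF circle_action_in[OF that]] \<psi>[OF that] by (simp add: bundle_proj_def circle_action_def)
  then show "has_weight (circle_bundle A L h) 0 (\<lambda>p. complex_of_real (\<phi> p))"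
    unfolding has_weight_def by simp
qed

end

theorem proposition1p3:
  fixes A :: "('x, complex) chart set"
    and g :: "'x metric_field"
    and L :: "('x, 'l) line_bundle"
    and h :: "'x \<Rightarrow> 'l \<Rightarrow> 'l \<Rightarrow> complex"
    and nabla :: "('x, 'l) covariant_derivative"
    and G :: "('x \<times> ('l \<Rightarrow> complex)) metric_field"
  assumes "complex_atlas A"
    and "Hausdorff_space (atlas_topology A)"
    and "compact_space (atlas_topology A)"
    and "connected_space (atlas_topology A)"
    and "riemannian_metric A g"
    and "compatible_with_complex_structure A g"
    and "holomorphic_line_bundle A L"
    and "hermitian_metric A L h"
    and "metric_connection A L h nabla"
    and "kaluza_klein_metric A g L h nabla G"
  shows "(\<forall>\<phi>. eigenfunction (circle_bundle_atlas A L h) G \<phi> \<and>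
              has_weight (circle_bundle A L h) 0 (\<lambda>p. complex_of_real (\<phi> p)) \<longleftrightarrow>
            (\<exists>\<psi>. eigenfunction A g \<psi> \<and> (\<forall>p\<in>circle_bundle A L h. \<phi> p = \<psi> (bundle_proj p)))) \<and>
         (\<forall>\<psi>. eigenfunction A g \<psi> \<longrightarrow>
            nodal_set (circle_bundle_atlas A L h) (\<psi> \<circ> bundle_proj) =
              {p \<in> circle_bundle A L h. bundle_proj p \<in> nodal_set A \<psi>} \<and>
            nodal_domains (circle_bundle_atlas A L h) (\<psi> \<circ> bundle_proj) \<approx> nodal_domains A \<psi>)"
proof -
  interpret kaluza_klein_bundle A L h g nabla G
    by unfold_locales (use assms in auto)
  show ?thesis
  proof (intro conjI allI impI nodal_set_pullback nodal_domains_pullback)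
    fix \<phi> :: "'x \<times> ('l \<Rightarrow> complex) \<Rightarrow> real"
    show "eigenfunction P G \<phi> \<and> has_weight (circle_bundle A L h) 0 (\<lambda>p. complex_of_real (\<phi> p)) \<longleftrightarrow>
      (\<exists>\<psi>. eigenfunction A g \<psi> \<and> (\<forall>p\<in>circle_bundle A L h. \<phi> p = \<psi> (bundle_proj p)))"
      unfolding weight_zero_iff using eigenfunction_pullback[of \<phi>] by blast
  qed
qed

end
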